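(* Let $K$ be a compact subset of $\mathbb R^d$. Then a typical measure $\mu\in\mathcal P(K)$ satisfies $$\overline{\dim}_{*,B}(\mu)=\overline{\dim}_{B,\mathrm{loc}}(K)\qquad\text{and}\qquad \overline{\dim}_B^*(\mu)=\overline{\dim}_{B,\mathrm{loc,max}}(K).$$
   Context: $\mathcal P(K)$ is the set of Borel probability measures on $K$, endowed with the weak topology. A property holds for a typical measure of $\mathcal P(K)$ if it is satisfied by all elements of some dense $G_\delta$ subset of $\mathcal P(K)$. $B(x,r)$ is the open ball of centre $x$ and radius $r$ in $\mathbb R^d$. $\overline{\dim}_B(E)$ denotes the upper box dimension of a bounded set $E\subset\mathbb R^d$. For $\mu\in\mathcal P(K)$, the small and big upper box dimensions of $\mu$ are $$\overline{\dim}_{*,B}(\mu)=\inf_{\mu(E)>0}\overline{\dim}_B(E),\qquad \overline{\dim}_B^*(\mu)=\lim_{\varepsilon\to0^+}\ \inf_{\mu(E)>1-\varepsilon}\overline{\dim}_B(E),$$ where the infima are over Borel sets $E\subset K$. For a bounded set $E\subset\mathbb R^d$, the local upper box dimension of $E$ and the maximal local upper box dimension of $E$ are $$\overline{\dim}_{B,\mathrm{loc}}(E)=\inf_{x\in E}\inf_{r>0}\overline{\dim}_B\big(E\cap B(x,r)\big),\qquad \overline{\dim}_{B,\mathrm{loc,max}}(E)=\sup_{y\in E,\ \rho>0}\overline{\dim}_{B,\mathrm{loc}}\big(E\cap B(y,\rho)\big).$$ *)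

theory Defs
  imports "HOL-Probability.Probability"
begin

definition prob_measures_on :: "'a::topological_space set \<Rightarrow> 'a measure set" where
  "prob_measures_on K = {\<mu>. prob_space \<mu> \<and> sets \<mu> = sets (restrict_space borel K)}"

text \<open>
  The coarsest topology on the probability measures on a compact set \<open>K\<close> for which
  \<open>\<mu> \<mapsto> \<integral>f d\<mu>\<close> is continuous for every continuous real function \<open>f\<close> on \<open>K\<close>
  (such \<open>f\<close> are automatically bounded).
\<close>
definition weak_topology_on :: "'a::topological_space set \<Rightarrow> 'a measure topology" where
  "weak_topology_on K = topology_generated_by
     {{\<mu> \<in> prob_measures_on K. integral\<^sup>L \<mu> f \<in> U} | (f :: 'a \<Rightarrow> real) U.
        continuous_on K f \<and> open U}"

lemma topspace_weak_topology_on: "topspace (weak_topology_on K) = prob_measures_on K"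
proof -
  have "prob_measures_on K \<in> {{\<mu> \<in> prob_measures_on K. integral\<^sup>L \<mu> f \<in> U} | (f :: _ \<Rightarrow> real) U.
        continuous_on K f \<and> open U}"
    by (intro CollectI exI[of _ "\<lambda>_. 0"] exI[of _ UNIV]) auto
  then show ?thesis
    unfolding weak_topology_on_def topology_generated_by_topspace by blast
qed

definition typical_in :: "'b topology \<Rightarrow> ('b \<Rightarrow> bool) \<Rightarrow> bool" where
  "typical_in X P \<longleftrightarrow>
     (\<exists>G. gdelta_in X G \<and> X closure_of G = topspace X \<and> (\<forall>x\<in>G. P x))"

text \<open>
  Least number of open balls of radius \<open>r\<close> needed to cover \<open>E\<close>; meaningful only when a finite
  cover exists, e.g. for bounded subsets of a Euclidean space.
\<close>
definition covering_number :: "'a::metric_space set \<Rightarrow> real \<Rightarrow> nat" where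
  "covering_number E r = (LEAST n. \<exists>C. finite C \<and> card C = n \<and> E \<subseteq> (\<Union>x\<in>C. ball x r))"

text \<open>As \<open>ln 0 = 0\<close>, the empty set gets dimension 0.\<close>
definition upper_box_dim :: "'a::metric_space set \<Rightarrow> ereal" where
  "upper_box_dim E =
     Limsup (at_right 0) (\<lambda>r. ereal (ln (real (covering_number E r)) / (- ln r)))"

text \<open>
  For \<open>\<mu>\<close> in \<^term>\<open>prob_measures_on K\<close> with \<open>K\<close> compact, \<^term>\<open>sets \<mu>\<close> consists of the
  Borel subsets of \<open>K\<close>.
\<close>
definition small_upper_box_dim :: "'a::metric_space measure \<Rightarrow> ereal" where
  "small_upper_box_dim \<mu> = (INF E\<in>{E \<in> sets \<mu>. measure \<mu> E > 0}. upper_box_dim E)"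

definition big_upper_box_dim :: "'a::metric_space measure \<Rightarrow> ereal" where
  "big_upper_box_dim \<mu> =
     Lim (at_right 0) (\<lambda>\<epsilon>. INF E\<in>{E \<in> sets \<mu>. measure \<mu> E > 1 - \<epsilon>}. upper_box_dim E)"

definition local_upper_box_dim :: "'a::metric_space set \<Rightarrow> ereal" where
  "local_upper_box_dim E = (INF x\<in>E. INF r\<in>{0<..}. upper_box_dim (E \<inter> ball x r))"

definition max_local_upper_box_dim :: "'a::metric_space set \<Rightarrow> ereal" where
  "max_local_upper_box_dim E = (SUP y\<in>E. SUP \<rho>\<in>{0<..}. local_upper_box_dim (E \<inter> ball y \<rho>))"

end

theory Submission
  imports Defs
begin

text \<open>
  Let \<open>d(x)\<close> be the limit, as \<open>r\<close> decreases to 0, of the upper box dimension of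
  \<open>K \<inter> B(x,r)\<close>. Then the local dimension of \<open>K\<close> is the infimum \<open>s\<close> of \<open>d\<close>, and the
  maximal local dimension is the supremum \<open>S\<close> over all balls \<open>B\<close> centred in \<open>K\<close> of the
  infimum of \<open>d\<close> over \<open>K \<inter> B\<close>. As \<open>d\<close> is upper semicontinuous, the sets
  \<open>V\<^sub>q = {d \<ge> q}\<close> are closed. A number below \<open>s\<close> has \<open>V\<^sub>q = K\<close>; a number \<open>q\<close> below
  \<open>S\<close> has a \<open>V\<^sub>q\<close> with interior points relative to \<open>K\<close>; and if \<open>q > S\<close>, then
  \<open>{d < q}\<close> is open and dense in \<open>K\<close>.

  Both dimensions of a measure \<open>\<mu>\<close> can therefore be read off from three properties:
  \<open>\<mu>\<close> charges every ball centred in \<open>K\<close>; every set \<open>E\<close> with \<open>\<mu>(E \<inter> V\<^sub>q) > 0\<close> has dimension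
  at least \<open>t\<close> whenever \<open>t < q\<close>; and for \<open>q > S\<close> there are sets of dimension at most \<open>q\<close>
  whose measure is as close to 1 as desired. With rational parameters and quantitative
  versions these become countably many properties, and each of them holds on a dense open set
  of measures. Density rests on the fact that every nonempty open set contains a finitely
  supported measure together with all finitely supported measures that arise from it by spreading
  each atom within a small ball (\<open>weak_open_contains_spread_pmf\<close>).

  The first property asks only for an additional atom, and the third one for moving the
  atoms into the dense set \<open>{d < q}\<close>. The second one is the heart of the matter
  (\<open>dense_open_large_sets\<close>): an atom \<open>z\<close> in \<open>V\<^sub>q\<close> is spread uniformly over an \<open>r\<close>-separated
  set of points of \<open>K\<close> whose number is a large multiple of \<open>r\<close> to the power \<open>-t\<close>, for a scale
  \<open>r = r(z)\<close> at which covering \<open>K\<close> near \<open>z\<close> takes that many balls. A set that carries a fixed proportion of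
  the spread mass contains a fixed proportion of the points and so has a large covering
  number at scale \<open>r(z)/4\<close>. The scales of different atoms differ, but a set of noticeable measure
  must carry a fixed proportion of at least one atom, and one good scale is enough for a
  limit superior. All this survives small weak perturbations of the measure.

  Finally, countable intersections of dense open sets are dense (\<open>weak_topology_Baire\<close>): shrinking
  basic neighbourhoods are nested, and a limit point of their centres lies in all of them. The
  limit point exists because the probability measures on \<open>K\<close> are sequentially compact. That is
  reduced to Helly's selection theorem on the real line: \<open>K\<close> is a continuous image of a compact set of
  reals, by Cantor coding, and the coding map has a Borel right inverse along which
  measures on \<open>K\<close> can be lifted.
\<close>

section \<open>Covering numbers and upper box dimension\<close>

lemma bounded_finite_ball_cover:
  fixes E :: "'a::euclidean_space set"
  assumes "bounded E" "r > 0"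
  shows "\<exists>C. finite C \<and> E \<subseteq> (\<Union>x\<in>C. ball x r)"
proof -
  have "compact (closure E)" using assms(1) by (simp add: compact_closure)
  then obtain C where "C \<subseteq> closure E" "finite C" "closure E \<subseteq> (\<Union>x\<in>C. ball x r)"
    by (rule compactE_image[of "closure E" "closure E" "\<lambda>x. ball x r"]) (use assms(2) in auto)
  then show ?thesis using closure_subset by blast
qed

lemma covering_number_attained:
  fixes E :: "'a::euclidean_space set"
  assumes "bounded E" "r > 0"
  obtains C where "finite C" "card C = covering_number E r" "E \<subseteq> (\<Union>x\<in>C. ball x r)"
proof -
  have "\<exists>n C. finite C \<and> card C = n \<and> E \<subseteq> (\<Union>x\<in>C. ball x r)"
    using bounded_finite_ball_cover[OF assms] by auto
  then have "\<exists>C. finite C \<and> card C = covering_number E r \<and> E \<subseteq> (\<Union>x\<in>C. ball x r)"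
    unfolding covering_number_def by (rule LeastI_ex)
  then show ?thesis using that by auto
qed

lemma covering_number_le:
  assumes "finite C" "E \<subseteq> (\<Union>x\<in>C. ball x r)"
  shows "covering_number E r \<le> card C"
  unfolding covering_number_def using assms by (intro Least_le) auto

lemma covering_number_mono:
  fixes E :: "'a::euclidean_space set"
  assumes "E \<subseteq> E'" "bounded E'" "r > 0"
  shows "covering_number E r \<le> covering_number E' r"
proof -
  obtain C where C: "finite C" "card C = covering_number E' r" "E' \<subseteq> (\<Union>x\<in>C. ball x r)"
    using covering_number_attained[OF assms(2,3)] .
  show ?thesis unfolding C(2)[symmetric] by (rule covering_number_le) (use C assms(1) in auto)
qed

lemma covering_number_Un_le:
  fixes E :: "'a::euclidean_space set"
  assumes "bounded E" "bounded E'" "r > 0"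
  shows "covering_number (E \<union> E') r \<le> covering_number E r + covering_number E' r"
proof -
  obtain C where C: "finite C" "card C = covering_number E r" "E \<subseteq> (\<Union>x\<in>C. ball x r)"
    using covering_number_attained[OF assms(1,3)] .
  obtain C' where C': "finite C'" "card C' = covering_number E' r" "E' \<subseteq> (\<Union>x\<in>C'. ball x r)"
    using covering_number_attained[OF assms(2,3)] .
  have "covering_number (E \<union> E') r \<le> card (C \<union> C')"
    by (rule covering_number_le) (use C C' in auto)
  also have "\<dots> \<le> card C + card C'" by (rule card_Un_le)
  finally show ?thesis using C C' by simp
qed

text \<open>
  A ball of radius \<open>r/4\<close> can be within \<open>r/4\<close> of at most one point of an \<open>r\<close>-separated set.
  The points need to be close to \<open>E\<close> only, so that the bound also applies to sets \<open>E\<close>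
  charged by a small perturbation of a measure on \<open>F\<close>.
\<close>
lemma card_separated_le_covering_number:
  fixes E :: "'a::euclidean_space set"
  assumes "bounded E" "r > 0" "finite F"
    and sep: "\<And>a b. a \<in> F \<Longrightarrow> b \<in> F \<Longrightarrow> a \<noteq> b \<Longrightarrow> r \<le> dist a b"
    and near: "\<And>a. a \<in> F \<Longrightarrow> \<exists>e\<in>E. dist a e < r / 4"
  shows "card F \<le> covering_number E (r / 4)"
proof -
  obtain C where C: "finite C" "card C = covering_number E (r/4)" "E \<subseteq> (\<Union>x\<in>C. ball x (r/4))"
    using covering_number_attained[of E "r/4"] assms by auto
  have "\<exists>c\<in>C. dist a c < r / 2" if a: "a \<in> F" for a
  proof -
    obtain e where "e \<in> E" and e: "dist a e < r / 4" using near[OF a] by auto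
    then obtain c where "c \<in> C" "dist c e < r / 4" using C(3) by auto
    moreover have "dist a c \<le> dist a e + dist c e" by (rule dist_triangle2)
    ultimately show ?thesis using e by (intro bexI[of _ c]) linarith
  qed
  then obtain c where c: "\<And>a. a \<in> F \<Longrightarrow> c a \<in> C" "\<And>a. a \<in> F \<Longrightarrow> dist a (c a) < r / 2" by metis
  have "inj_on c F"
  proof (rule inj_onI, rule ccontr)
    fix a b assume ab: "a \<in> F" "b \<in> F" "c a = c b" "a \<noteq> b"
    have "dist a b \<le> dist a (c a) + dist b (c a)" by (rule dist_triangle2)
    then show False using c(2)[OF ab(1)] c(2)[OF ab(2)] sep[OF ab(1,2,4)] ab(3) by simp
  qed
  then show ?thesis using C c(1) by (metis card_inj_on_le image_subsetI)
qed

text \<open>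
  A separated set of maximal cardinality exists by the previous bound, and by maximality the
  balls around its points cover \<open>A\<close>.
\<close>
lemma large_separated_subset:
  fixes A :: "'a::euclidean_space set"
  assumes "bounded A" "r > 0"
  obtains F where "finite F" "F \<subseteq> A" "\<And>a b. a \<in> F \<Longrightarrow> b \<in> F \<Longrightarrow> a \<noteq> b \<Longrightarrow> r \<le> dist a b"
    "covering_number A r \<le> card F"
proof -
  define P where "P F \<longleftrightarrow> finite F \<and> F \<subseteq> A \<and> (\<forall>a\<in>F. \<forall>b\<in>F. a \<noteq> b \<longrightarrow> r \<le> dist a b)" for F
  have "P {}" by (simp add: P_def)
  moreover have "\<forall>F. P F \<longrightarrow> card F < Suc (covering_number A (r/4))"
  proof (intro allI impI)
    fix F assume F: "P F"
    have "card F \<le> covering_number A (r/4)"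
    proof (rule card_separated_le_covering_number[OF assms])
      fix a assume "a \<in> F"
      then have "a \<in> A" using F by (auto simp: P_def)
      then show "\<exists>e\<in>A. dist a e < r / 4" using assms(2) by (intro bexI[of _ a]) simp_all
    qed (use F in \<open>simp_all add: P_def\<close>)
    then show "card F < Suc (covering_number A (r/4))" by simp
  qed
  ultimately obtain F where F: "P F" and max: "\<forall>G. P G \<longrightarrow> card G \<le> card F"
    using ex_has_greatest_nat[of P "{}" card] by blast
  have "A \<subseteq> (\<Union>x\<in>F. ball x r)"
  proof (rule ccontr)
    assume "\<not> A \<subseteq> (\<Union>x\<in>F. ball x r)"
    then obtain x where x: "x \<in> A" "\<And>y. y \<in> F \<Longrightarrow> r \<le> dist y x" by (force simp: not_less)
    then have "x \<notin> F" using assms(2) by force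
    have "P (insert x F)" using F x by (auto simp: P_def dist_commute)
    then have "card (insert x F) \<le> card F" using max by blast
    then show False using \<open>x \<notin> F\<close> F by (simp add: P_def)
  qed
  then have "covering_number A r \<le> card F" using F by (intro covering_number_le) (auto simp: P_def)
  then show ?thesis using that F by (auto simp: P_def)
qed

lemma upper_box_dim_nonneg: "0 \<le> upper_box_dim E"
proof (rule ccontr)
  assume "\<not> 0 \<le> upper_box_dim E"
  then have "\<forall>\<^sub>F r in at_right 0. ereal (ln (real (covering_number E r)) / (- ln r)) < 0"
    unfolding upper_box_dim_def by (intro Limsup_lessD) auto
  moreover have "\<forall>\<^sub>F r in at_right (0::real). 0 < r \<and> r < 1"
    using eventually_at_right_less[of "0::real"] by (auto intro: eventually_conj eventually_at_right_real[of 0 1, simplified])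
  ultimately have "\<forall>\<^sub>F r in at_right (0::real). False"
  proof eventually_elim
    case (elim r)
    have "0 \<le> ln (real (covering_number E r))" by (cases "covering_number E r") auto
    moreover have "0 < - ln r" using elim by simp
    ultimately have "0 \<le> ln (real (covering_number E r)) / (- ln r)" by (intro divide_nonneg_pos)
    then show ?case using elim by simp
  qed
  then show False by simp
qed

lemma upper_box_dim_mono:
  fixes E :: "'a::euclidean_space set"
  assumes "E \<subseteq> E'" "bounded E'"
  shows "upper_box_dim E \<le> upper_box_dim E'"
  unfolding upper_box_dim_def
proof (rule Limsup_mono)
  have "\<forall>\<^sub>F r in at_right (0::real). r \<in> {0<..<1}" by (rule eventually_at_right_real) simp
  then show "\<forall>\<^sub>F r in at_right 0. ereal (ln (real (covering_number E r)) / - ln r)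
      \<le> ereal (ln (real (covering_number E' r)) / - ln r)"
  proof eventually_elim
    case (elim r)
    have le: "covering_number E r \<le> covering_number E' r"
      using elim assms by (intro covering_number_mono) auto
    have "ln (real (covering_number E r)) \<le> ln (real (covering_number E' r))"
    proof (cases "covering_number E r = 0")
      case True
      then show ?thesis by (cases "covering_number E' r") auto
    qed (use le in auto)
    then have "ln (real (covering_number E r)) / - ln r \<le> ln (real (covering_number E' r)) / - ln r"
      using elim by (intro divide_right_mono) auto
    then show ?case by simp
  qed
qed

lemma upper_box_dim_empty: "upper_box_dim ({} :: 'a::metric_space set) = 0"
proof -
  have "covering_number ({} :: 'a set) r = 0" for r
    using covering_number_le[of "{}" "{} :: 'a set" r] by simp
  then show ?thesis unfolding upper_box_dim_def by (simp add: Limsup_const zero_ereal_def)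
qed

text \<open>
  The covering number of the union is at most twice the larger of the two, and the
  factor 2 contributes \<open>ln 2 / - ln r\<close>, which tends to 0.
\<close>
lemma upper_box_dim_Un_le:
  fixes A B :: "'a::euclidean_space set"
  assumes "bounded A" "bounded B" "upper_box_dim A \<le> ereal q" "upper_box_dim B \<le> ereal q"
  shows "upper_box_dim (A \<union> B) \<le> ereal q"
proof (rule ereal_le_epsilon2)
  fix e :: real assume e: "0 < e"
  \<comment> \<open>For such \<open>r\<close> the contribution of the factor 2 is at most \<open>e/2\<close>.\<close>
  have small: "\<forall>\<^sub>F r in at_right (0::real). r \<in> {0<..<min 1 (exp (- (ln 2 / (e/2))))}"
    by (rule eventually_at_right_real) simp
  have ev: "\<forall>\<^sub>F r in at_right 0. ereal (ln (real (covering_number X r)) / - ln r) < ereal (q + e/2)"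
    if "upper_box_dim X \<le> ereal q" for X :: "'a set"
    using that e unfolding upper_box_dim_def by (intro Limsup_lessD) (auto elim: order_le_less_trans)
  have "\<forall>\<^sub>F r in at_right 0. ereal (ln (real (covering_number (A \<union> B) r)) / - ln r) \<le> ereal (q + e)"
    using small ev[OF assms(3)] ev[OF assms(4)]
  proof eventually_elim
    case (elim r)
    define N where "N X = covering_number X r" for X :: "'a set"
    define m where "m = max (N A) (N B)"
    have l: "0 < - ln r" using elim by simp
    have "ln 2 / (e/2) \<le> - ln r"
    proof -
      have "ln r \<le> ln (exp (- (ln 2 / (e/2))))" using elim by (subst ln_le_cancel_iff) auto
      then show ?thesis by simp
    qed
    then have l2: "ln 2 \<le> (e/2) * - ln r" using e by (simp add: field_simps)
    have Nm: "ln (real (N X)) \<le> (q + e/2) * - ln r" if "X = A \<or> X = B" for X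
      using that elim l by (auto simp: N_def field_simps)
    have m: "ln (real m) \<le> (q + e/2) * - ln r"
      using Nm[of A] Nm[of B] unfolding m_def by (auto simp: max_def)
    have "0 \<le> ln (real m)" by (cases m) auto
    then have m0: "0 \<le> (q + e/2) * - ln r" using m by linarith
    have "N (A \<union> B) \<le> N A + N B" unfolding N_def using elim assms by (intro covering_number_Un_le) auto
    then have le: "N (A \<union> B) \<le> 2 * m" unfolding m_def by simp
    have "ln (real (N (A \<union> B))) \<le> ln 2 + (q + e/2) * - ln r"
    proof (cases "N (A \<union> B) = 0")
      case True
      have "0 \<le> ln (2::real)" by simp
      moreover have "ln (real (N (A \<union> B))) = 0" using True by simp
      ultimately show ?thesis using m0 by linarith
    next
      case False
      then have "0 < m" using le by simp
      have "ln (real (N (A \<union> B))) \<le> ln (2 * real m)"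
        using False \<open>0 < m\<close> of_nat_mono[OF le, where 'a = real] by (subst ln_le_cancel_iff) auto
      also have "\<dots> = ln 2 + ln (real m)" using \<open>0 < m\<close> by (simp add: ln_mult)
      finally show ?thesis using m by simp
    qed
    then have "ln (real (N (A \<union> B))) \<le> (q + e) * - ln r" using l2 by (simp add: algebra_simps)
    then have "ln (real (N (A \<union> B))) / - ln r \<le> q + e" using l by (subst pos_divide_le_eq) auto
    then show ?case by (simp add: N_def)
  qed
  then show "upper_box_dim (A \<union> B) \<le> ereal q + ereal e"
    unfolding upper_box_dim_def by (intro Limsup_bounded) simp
qed

lemma upper_box_dim_finite_UN_le:
  fixes A :: "'i \<Rightarrow> 'a::euclidean_space set"
  assumes "finite I" "0 \<le> q" "\<And>i. i \<in> I \<Longrightarrow> bounded (A i) \<and> upper_box_dim (A i) \<le> ereal q"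
  shows "upper_box_dim (\<Union>i\<in>I. A i) \<le> ereal q"
  using assms(1,3)
proof (induction I)
  case empty
  then show ?case using assms(2) by (simp add: upper_box_dim_empty)
next
  case (insert i I)
  then show ?case by (simp add: upper_box_dim_Un_le bounded_UN)
qed

lemma upper_box_dim_geI:
  assumes scale: "\<And>\<delta>. \<delta> > 0 \<Longrightarrow> \<exists>r>0. r < \<delta> \<and> r powr (- t) \<le> real (covering_number E r)"
  shows "ereal t \<le> upper_box_dim E"
proof (rule ccontr)
  assume "\<not> ereal t \<le> upper_box_dim E"
  then have "\<forall>\<^sub>F r in at_right 0. ereal (ln (real (covering_number E r)) / (- ln r)) < ereal t"
    unfolding upper_box_dim_def by (intro Limsup_lessD) auto
  then obtain b where b: "b > 0" "\<And>r. 0 < r \<Longrightarrow> r < b \<Longrightarrow> ln (real (covering_number E r)) / (- ln r) < t"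
    by (auto simp: eventually_at_right_field)
  obtain r where r: "0 < r" "r < min b 1" "r powr (- t) \<le> real (covering_number E r)"
    using scale[of "min b 1"] b(1) by auto
  have "0 < r powr (- t)" using r by simp
  then have "ln (r powr (- t)) \<le> ln (real (covering_number E r))"
    using r(3) by (subst ln_le_cancel_iff) linarith+
  then have "t * - ln r \<le> ln (real (covering_number E r))" using r by (simp add: ln_powr)
  moreover have "0 < - ln r" using r by simp
  ultimately have "t \<le> ln (real (covering_number E r)) / (- ln r)" by (subst pos_le_divide_eq) auto
  then show False using b(2)[of r] r by simp
qed

text \<open>
  Passing to some \<open>t'\<close> strictly between \<open>t\<close> and the dimension leaves a factor
  \<open>r powr - (t' - t)\<close>, which absorbs any constant. The scale \<open>r / 4\<close> is the one at which
  \<open>card_separated_le_covering_number\<close> bounds an \<open>r\<close>-separated set.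
\<close>
lemma upper_box_dim_frequent_scale:
  assumes t: "0 \<le> t" "ereal t < upper_box_dim A" and "c > 0" "\<delta> > 0"
  shows "\<exists>r>0. r < \<delta> \<and> c * (r / 4) powr (- t) \<le> real (covering_number A r)"
proof -
  obtain t' where t': "t < t'" "ereal t' < upper_box_dim A"
    using ereal_dense2[OF t(2)] by auto
  define B where "B = c * 4 powr t"
  define b where "b = B powr (- (1 / (t' - t)))"
  have B: "B > 0" "b > 0" using assms(3) by (auto simp: B_def b_def)
  have ev: "\<forall>\<^sub>F r in at_right (0::real). r \<in> {0<..<min (min 1 \<delta>) b}"
    by (rule eventually_at_right_real) (use assms(4) B in auto)
  have "\<not> (\<forall>\<^sub>F r in at_right 0. ereal (ln (real (covering_number A r)) / (- ln r)) \<le> ereal t')"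
  proof
    assume "\<forall>\<^sub>F r in at_right 0. ereal (ln (real (covering_number A r)) / (- ln r)) \<le> ereal t'"
    then have "upper_box_dim A \<le> ereal t'" unfolding upper_box_dim_def by (rule Limsup_bounded)
    then show False using t'(2) by simp
  qed
  then have "\<exists>\<^sub>F r in at_right 0. t' < ln (real (covering_number A r)) / (- ln r)"
    by (simp add: frequently_def not_less)
  then obtain r where r: "0 < r" "r < 1" "r < \<delta>" "r < b" and big: "t' < ln (real (covering_number A r)) / (- ln r)"
    using frequently_eventually_frequently[OF _ ev] by (auto dest: frequently_ex)
  have l: "0 < - ln r" using r by simp
  have lnN: "t' * - ln r < ln (real (covering_number A r))"
    using big l by (subst (asm) pos_less_divide_eq) auto
  have "0 < t' * - ln r" using t t' l by (intro mult_pos_pos) auto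
  then have N: "0 < covering_number A r" using lnN by (cases "covering_number A r") auto
  have "- (1 / (t' - t)) * - (t' - t) = 1" using t'(1) by (simp add: field_simps)
  then have "B = b powr (- (t' - t))" using B by (simp only: b_def powr_powr) simp
  also have "\<dots> \<le> r powr (- (t' - t))" using r t' by (intro powr_mono2') auto
  finally have "B * r powr (- t) \<le> r powr (- (t' - t)) * r powr (- t)" by (intro mult_right_mono) auto
  also have "\<dots> = r powr (- t')" by (simp add: powr_add[symmetric])
  also have "\<dots> = exp (t' * - ln r)" using r by (simp add: powr_def)
  also have "\<dots> \<le> exp (ln (real (covering_number A r)))" using lnN by simp
  also have "\<dots> = real (covering_number A r)" using N by simp
  finally have "B * r powr (- t) \<le> real (covering_number A r)" .
  moreover have "c * (r / 4) powr (- t) = B * r powr (- t)"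
    using r by (simp add: B_def powr_divide powr_minus field_simps)
  ultimately show ?thesis using r by auto
qed

text \<open>
  The function \<open>d\<close> through which both local dimensions of \<open>K\<close> are expressed.
\<close>
definition pointwise_upper_box_dim :: "'a::metric_space set \<Rightarrow> 'a \<Rightarrow> ereal" where
  "pointwise_upper_box_dim K x = (INF r\<in>{0<..}. upper_box_dim (K \<inter> ball x r))"

lemma pointwise_upper_box_dim_less_iff:
  "pointwise_upper_box_dim K x < q \<longleftrightarrow> (\<exists>r>0. upper_box_dim (K \<inter> ball x r) < q)"
  by (auto simp: pointwise_upper_box_dim_def INF_less_iff)

text \<open>
  Upper semicontinuity: a ball witnessing \<open>d(x) < q\<close> contains balls witnessing it for
  all points near \<open>x\<close>.
\<close>
lemma closed_pointwise_upper_box_dim_ge: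
  fixes K :: "'a::euclidean_space set"
  assumes "compact K"
  shows "closed {x \<in> K. q \<le> pointwise_upper_box_dim K x}"
proof -
  let ?d = "pointwise_upper_box_dim K"
  have "open {x. ?d x < q}"
  proof (rule openI)
    fix x assume "x \<in> {x. ?d x < q}"
    then obtain r where r: "r > 0" "upper_box_dim (K \<inter> ball x r) < q"
      by (auto simp: pointwise_upper_box_dim_less_iff)
    have "?d y < q" if y: "y \<in> ball x r" for y
    proof -
      obtain r' where r': "r' > 0" "ball y r' \<subseteq> ball x r"
        using y open_ball openE by blast
      have "upper_box_dim (K \<inter> ball y r') \<le> upper_box_dim (K \<inter> ball x r)"
        using r'(2) assms by (intro upper_box_dim_mono) (auto intro: bounded_Int compact_imp_bounded)
      then show ?thesis using r r'(1) by (auto simp: pointwise_upper_box_dim_less_iff)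
    qed
    then show "\<exists>e>0. ball x e \<subseteq> {x. ?d x < q}" using r(1) by auto
  qed
  then have "closed (K \<inter> - {x. ?d x < q})"
    using compact_imp_closed[OF assms] by (intro closed_Int) auto
  moreover have "K \<inter> - {x. ?d x < q} = {x \<in> K. q \<le> ?d x}" by auto
  ultimately show ?thesis by simp
qed

lemma pointwise_upper_box_dim_localize:
  fixes K :: "'a::euclidean_space set"
  assumes "bounded K" "x \<in> ball y \<rho>"
  shows "pointwise_upper_box_dim (K \<inter> ball y \<rho>) x = pointwise_upper_box_dim K x"
proof (rule antisym)
  show "pointwise_upper_box_dim (K \<inter> ball y \<rho>) x \<le> pointwise_upper_box_dim K x"
    unfolding pointwise_upper_box_dim_def
    using assms by (intro INF_mono) (auto intro!: upper_box_dim_mono bounded_Int)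
  show "pointwise_upper_box_dim K x \<le> pointwise_upper_box_dim (K \<inter> ball y \<rho>) x"
    unfolding pointwise_upper_box_dim_def
  proof (rule INF_mono)
    fix r :: real assume "r \<in> {0<..}"
    then have "x \<in> ball y \<rho> \<inter> ball x r" using assms(2) by auto
    then obtain r' where r': "r' > 0" "ball x r' \<subseteq> ball y \<rho> \<inter> ball x r"
      by (meson openE open_Int open_ball)
    then show "\<exists>r'\<in>{0<..}. upper_box_dim (K \<inter> ball x r') \<le> upper_box_dim (K \<inter> ball y \<rho> \<inter> ball x r)"
      using assms(1) by (intro bexI[of _ r'] upper_box_dim_mono) (auto intro: bounded_Int)
  qed
qed

lemma local_upper_box_dim_eq_INF:
  "local_upper_box_dim K = (INF x\<in>K. pointwise_upper_box_dim K x)"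
  by (simp add: local_upper_box_dim_def pointwise_upper_box_dim_def)

lemma max_local_upper_box_dim_eq:
  fixes K :: "'a::euclidean_space set"
  assumes "bounded K"
  shows "max_local_upper_box_dim K =
    (SUP y\<in>K. SUP \<rho>\<in>{0<..}. INF x\<in>K \<inter> ball y \<rho>. pointwise_upper_box_dim K x)"
  unfolding max_local_upper_box_dim_def local_upper_box_dim_eq_INF
  using pointwise_upper_box_dim_localize[OF assms] by (intro SUP_cong INF_cong) auto

section \<open>Compact sets as images of compact sets of reals\<close>

text \<open>
  With \<open>c = 1/2\<close> this is the number with binary digits \<open>b\<close>; with \<open>c = 1/3\<close> it is an
  injective coding of sequences by the points of a Cantor set.
\<close>
definition digit_sum :: "real \<Rightarrow> (nat \<Rightarrow> bool) \<Rightarrow> real" where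
  "digit_sum c b = (\<Sum>i. c ^ Suc i * of_bool (b i))"

lemma summable_digits:
  fixes c :: real assumes "0 < c" "c < 1"
  shows "summable (\<lambda>i. c ^ Suc i * of_bool (b i))"
proof (rule summable_comparison_test')
  show "summable (\<lambda>i. c ^ Suc i)" using assms by (simp add: summable_geometric)
  show "norm (c ^ Suc i * of_bool (b i)) \<le> c ^ Suc i" for i using assms by (auto simp: of_bool_def)
qed

lemma compact_UNIV_bool_sequences: "compact (UNIV :: (nat \<Rightarrow> bool) set)"
proof -
  have "compact_space (product_topology (\<lambda>_::nat. euclidean :: bool topology) UNIV)"
    by (subst compact_space_product_topology) (auto simp: compact_space_def finite_imp_compact)
  then show ?thesis
    by (simp add: euclidean_product_topology compact_space_def)
qed

lemma continuous_digit_sum: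
  assumes "0 < c" "c < 1"
  shows "continuous_on UNIV (digit_sum c)"
proof -
  have "uniform_limit UNIV (\<lambda>n b. \<Sum>i<n. c ^ Suc i * of_bool (b i)) (\<lambda>b. \<Sum>i. c ^ Suc i * of_bool (b i)) sequentially"
    by (rule Weierstrass_m_test[where M="\<lambda>i. c ^ Suc i"])
       (use assms in \<open>auto simp: of_bool_def summable_geometric\<close>)
  moreover have "continuous_on UNIV (\<lambda>b. \<Sum>i<n. c ^ Suc i * of_bool (b i))" for n :: nat
  proof -
    have "continuous_on UNIV (\<lambda>b. of_bool (b i) :: real)" for i :: nat
      using continuous_on_compose[of UNIV "\<lambda>b. b i" "of_bool :: bool \<Rightarrow> real"]
      by (simp add: comp_def continuous_on_discrete)
    then show ?thesis by (intro continuous_intros)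
  qed
  ultimately show ?thesis
    unfolding digit_sum_def[abs_def]
    by (intro uniform_limit_theorem[where F=sequentially]) auto
qed

text \<open>
  At the first position \<open>n\<close> where the sequences differ, the digit weighs \<open>3\<close> to the power \<open>- (n + 1)\<close>,
  twice as much as all later digits together.
\<close>
lemma digit_sum_third_less:
  assumes "b n" "\<not> b' n" "\<And>i. i < n \<Longrightarrow> b i = b' i"
  shows "digit_sum (1/3) b' < digit_sum (1/3) b"
proof -
  let ?f = "\<lambda>b i. (1/3::real) ^ Suc i * of_bool (b i)"
  note S = summable_digits[of "1/3"]
  have geo: "summable (\<lambda>i. (1/3::real) ^ Suc (i + Suc n))"
    using summable_ignore_initial_segment[of "\<lambda>i. (1/3::real) ^ i" "Suc (Suc n)"] by (simp add: summable_geometric)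
  have "(\<Sum>i. ?f b' (i + Suc n)) \<le> (\<Sum>i. (1/3) ^ Suc (i + Suc n))"
    using summable_ignore_initial_segment[OF S, of "Suc n" b']
    by (intro suminf_le[OF _ _ geo]) (auto simp: of_bool_def)
  also have "\<dots> = (1/3) ^ Suc (Suc n) * (\<Sum>i. (1/3::real) ^ i)"
    by (subst suminf_mult[symmetric]) (auto simp: summable_geometric power_add mult_ac)
  also have "\<dots> = (1/3) ^ Suc n / 2"
    by (simp add: suminf_geometric)
  also have "\<dots> < (1/3) ^ Suc n" by simp
  finally have tail: "(\<Sum>i. ?f b' (i + Suc n)) < (1/3) ^ Suc n" .
  have "digit_sum (1/3) b' = (\<Sum>i. ?f b' (i + Suc n)) + (\<Sum>i<Suc n. ?f b' i)"
    unfolding digit_sum_def by (rule suminf_split_initial_segment) (simp add: S del: power_Suc)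
  also have "\<dots> < (1/3) ^ Suc n + (\<Sum>i<n. ?f b i)"
    using tail assms by simp
  also have "\<dots> = (\<Sum>i<Suc n. ?f b i)" using assms by simp
  also have "\<dots> \<le> digit_sum (1/3) b"
    unfolding digit_sum_def by (rule sum_le_suminf) (use S in \<open>auto simp del: power_Suc\<close>)
  finally show ?thesis .
qed

lemma inj_digit_sum_third: "inj (digit_sum (1/3))"
proof (rule injI, rule ccontr)
  fix b b' :: "nat \<Rightarrow> bool"
  assume eq: "digit_sum (1/3) b = digit_sum (1/3) b'" and "b \<noteq> b'"
  then have ex: "\<exists>n. b n \<noteq> b' n" by auto
  define n where "n = (LEAST n. b n \<noteq> b' n)"
  have "b n \<noteq> b' n" unfolding n_def by (rule LeastI_ex[OF ex])
  moreover have "b i = b' i" if "i < n" for i using not_less_Least that unfolding n_def by blast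
  ultimately show False
    using digit_sum_third_less[of b n b'] digit_sum_third_less[of b' n b] eq
    by (cases "b n") auto
qed

text \<open>
  The partial sums of the expansion are \<open>\<lfloor>2\<^sup>n x\<rfloor> / 2\<^sup>n\<close>. Only \<open>x = 1\<close> escapes, for which
  all digits are 1.
\<close>
lemma binary_expansion:
  fixes x :: real assumes "0 \<le> x" "x \<le> 1"
  shows "\<exists>b. digit_sum (1/2) b = x"
proof (cases "x = 1")
  case True
  have "digit_sum (1/2) (\<lambda>_. True) = 1"
    unfolding digit_sum_def using suminf_mult[of "\<lambda>i. (1/2::real) ^ i" "1/2"]
    by (simp add: suminf_geometric summable_geometric)
  then show ?thesis using True by blast
next
  case False
  define b where "b i = odd \<lfloor>2 ^ Suc i * x\<rfloor>" for i
  have part: "(\<Sum>i<n. (1/2) ^ Suc i * of_bool (b i)) = of_int \<lfloor>2 ^ n * x\<rfloor> / (2::real) ^ n" for n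
  proof (induction n)
    case 0
    have "\<lfloor>x\<rfloor> = 0" using assms False by (simp add: floor_eq_iff)
    then show ?case by simp
  next
    case (Suc n)
    have "\<lfloor>2 ^ n * x\<rfloor> = \<lfloor>2 ^ Suc n * x\<rfloor> div 2"
      using floor_divide_real_eq_div[of 2 "2 ^ Suc n * x"] by simp
    then have "\<lfloor>2 ^ Suc n * x\<rfloor> = 2 * \<lfloor>2 ^ n * x\<rfloor> + of_bool (b n)"
      unfolding b_def by (metis mult_div_mod_eq mod2_eq_if of_bool_eq)
    then have "of_int \<lfloor>2 ^ Suc n * x\<rfloor> = 2 * of_int \<lfloor>2 ^ n * x\<rfloor> + (of_bool (b n) :: real)"
      by (metis of_int_add of_int_mult of_int_numeral of_int_of_bool)
    then show ?case using Suc by (simp add: field_simps)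
  qed
  have "(\<lambda>n. of_int \<lfloor>2 ^ n * x\<rfloor> / (2::real) ^ n) \<longlonglongrightarrow> x"
  proof (rule real_tendsto_sandwich)
    show "\<forall>\<^sub>F n in sequentially. x - (1/2) ^ n \<le> of_int \<lfloor>2 ^ n * x\<rfloor> / (2::real) ^ n"
    proof (rule always_eventually, rule allI)
      fix n :: nat
      have "2 ^ n * x - 1 \<le> of_int \<lfloor>2 ^ n * x\<rfloor>" by linarith
      then have "(2 ^ n * x - 1) / 2 ^ n \<le> of_int \<lfloor>2 ^ n * x\<rfloor> / (2::real) ^ n"
        by (rule divide_right_mono) simp
      then show "x - (1/2) ^ n \<le> of_int \<lfloor>2 ^ n * x\<rfloor> / (2::real) ^ n"
        by (simp add: diff_divide_distrib power_divide)
    qed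
    show "\<forall>\<^sub>F n in sequentially. of_int \<lfloor>2 ^ n * x\<rfloor> / (2::real) ^ n \<le> x"
      by (rule always_eventually) (auto simp: field_simps)
    show "(\<lambda>n. x - (1/2) ^ n) \<longlonglongrightarrow> x"
      using tendsto_diff[OF tendsto_const LIMSEQ_power_zero[of "1/2::real"], of x] by simp
  qed simp
  then have "(\<lambda>i. (1/2) ^ Suc i * of_bool (b i)) sums x"
    unfolding sums_def by (simp only: part)
  then show ?thesis unfolding digit_sum_def by (auto dest: sums_unique)
qed

text \<open>
  A binary sequence, split into one subsequence per coordinate, describes a point of a cube
  that contains \<open>K\<close>; this is a continuous map \<open>\<Phi>\<close> onto the cube. The space of
  sequences is compact, so the injective coding by \<open>digit_sum (1/3)\<close> is a homeomorphism onto
  a set of reals, and \<open>C\<close> is the image of the preimage of \<open>K\<close> under \<open>\<Phi>\<close>.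
\<close>
lemma compact_continuous_image_of_real_compact:
  fixes K :: "'a::euclidean_space set"
  assumes "compact K"
  obtains C :: "real set" and \<phi> :: "real \<Rightarrow> 'a"
  where "compact C" "continuous_on C \<phi>" "\<phi> ` C = K"
proof -
  obtain B where B: "B > 0" "\<And>x. x \<in> K \<Longrightarrow> norm x \<le> B"
    using compact_imp_bounded[OF assms] unfolding bounded_pos by auto
  define digit where "digit j b = (\<lambda>i::nat. b (prod_encode (i, to_nat_on Basis j)) :: bool)" for j :: 'a and b
  define \<Phi> where "\<Phi> b = (\<Sum>j\<in>Basis. (2 * B * digit_sum (1/2) (digit j b) - B) *\<^sub>R (j::'a))" for b
  let ?e = "digit_sum (1/3)"
  have cont_digit: "continuous_on UNIV (digit j)" for j :: 'a
    unfolding digit_def by (intro continuous_on_coordinatewise_then_product continuous_on_product_coordinates)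
  have "continuous_on UNIV (\<lambda>b. digit_sum (1/2) (digit j b))" for j :: 'a
    by (rule continuous_on_compose2[OF continuous_digit_sum _ subset_UNIV]) (auto intro: cont_digit)
  then have cont\<Phi>: "continuous_on UNIV \<Phi>"
    unfolding \<Phi>_def by (intro continuous_intros)
  have surj: "K \<subseteq> range \<Phi>"
  proof
    fix x assume x: "x \<in> K"
    have "\<exists>b. digit_sum (1/2) b = (x \<bullet> j + B) / (2 * B)" if j: "j \<in> Basis" for j
    proof (rule binary_expansion)
      have "\<bar>x \<bullet> j\<bar> \<le> B" using B(2)[OF x] Basis_le_norm[OF j, of x] by linarith
      then show "0 \<le> (x \<bullet> j + B) / (2 * B)" "(x \<bullet> j + B) / (2 * B) \<le> 1" using B(1) by (auto simp: field_simps)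
    qed
    then obtain \<beta> where \<beta>: "\<And>j. j \<in> Basis \<Longrightarrow> digit_sum (1/2) (\<beta> j) = (x \<bullet> j + B) / (2 * B)" by metis
    define b where "b n = (case prod_decode n of (i, k) \<Rightarrow> \<beta> (from_nat_into Basis k) i)" for n
    have "digit j b = \<beta> j" if "j \<in> Basis" for j
      using that by (auto simp: digit_def b_def countable_finite)
    then have "\<Phi> b = (\<Sum>j\<in>Basis. (x \<bullet> j) *\<^sub>R j)"
      unfolding \<Phi>_def using \<beta> B(1) by (intro sum.cong) auto
    then show "x \<in> range \<Phi>" by (metis euclidean_representation rangeI)
  qed
  obtain g where g: "homeomorphism UNIV (range ?e) ?e g"
    using homeomorphism_compact[OF compact_UNIV_bool_sequences continuous_digit_sum refl inj_digit_sum_third] by auto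
  have compD: "compact (\<Phi> -` K)"
    using cont\<Phi> compact_imp_closed[OF assms] compact_UNIV_bool_sequences
    by (metis closed_vimage compact_Int_closed inf_top_left continuous_on_eq_continuous_at open_UNIV isCont_def)
  show ?thesis
  proof
    show "compact (?e ` (\<Phi> -` K))"
      by (rule compact_continuous_image[OF continuous_on_subset[OF continuous_digit_sum subset_UNIV] compD]) auto
    show "continuous_on (?e ` (\<Phi> -` K)) (\<lambda>t. \<Phi> (g t))"
      by (rule continuous_on_compose2[OF cont\<Phi> continuous_on_subset[OF homeomorphism_cont2[OF g]]]) auto
    have "g (?e b) = b" for b using homeomorphism_apply1[OF g] by simp
    then show "(\<lambda>t. \<Phi> (g t)) ` ?e ` (\<Phi> -` K) = K"
      using surj by (force simp: image_image)
  qed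
qed

section \<open>Sequential compactness of the probability measures\<close>

text \<open>
  The least preimage \<open>s x\<close> of \<open>x\<close> depends measurably on \<open>x\<close>, because \<open>s x \<le> a\<close> says that
  \<open>x\<close> lies in the compact set \<open>\<phi> ` (C \<inter> {..a})\<close>.
\<close>
lemma borel_section_of_real_compact:
  fixes \<phi> :: "real \<Rightarrow> 'a::euclidean_space"
  assumes C: "compact C" and \<phi>: "continuous_on C \<phi>" "\<phi> ` C = K"
  obtains s where "s \<in> borel_measurable (restrict_space borel K)"
    "\<And>x. x \<in> K \<Longrightarrow> s x \<in> C" "\<And>x. x \<in> K \<Longrightarrow> \<phi> (s x) = x"
proof -
  have "\<exists>t. (t \<in> C \<and> \<phi> t = x) \<and> (\<forall>u. u \<in> C \<and> \<phi> u = x \<longrightarrow> t \<le> u)" if "x \<in> K" for x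
  proof -
    have "closed {t \<in> C. \<phi> t = x}"
      using continuous_closed_preimage_constant[OF \<phi>(1) compact_imp_closed[OF C]] .
    then have "compact {t \<in> C. \<phi> t = x}"
      using C by (metis (no_types, lifting) compact_Int_closed inf.absorb_iff2 mem_Collect_eq subsetI)
    then show ?thesis
      using compact_attains_inf[of "{t \<in> C. \<phi> t = x}"] that \<phi>(2) by (auto simp: image_iff)
  qed
  then obtain s where s: "\<And>x. x \<in> K \<Longrightarrow> s x \<in> C \<and> \<phi> (s x) = x"
    and least: "\<And>x u. x \<in> K \<Longrightarrow> u \<in> C \<Longrightarrow> \<phi> u = x \<Longrightarrow> s x \<le> u" by metis
  have "{x \<in> space (restrict_space borel K). s x \<le> a} \<in> sets (restrict_space borel K)" for a
  proof -
    have eq: "{x \<in> space (restrict_space borel K). s x \<le> a} = \<phi> ` (C \<inter> {..a})"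
      (is "?L = ?R")
    proof
      show "?L \<subseteq> ?R" using s by (force simp: space_restrict_space image_iff)
      show "?R \<subseteq> ?L" using least \<phi>(2) by (force simp: space_restrict_space)
    qed
    have "compact (\<phi> ` (C \<inter> {..a}))"
      using C \<phi>(1) by (intro compact_continuous_image compact_Int_closed) (auto intro: continuous_on_subset)
    then have "closed (\<phi> ` (C \<inter> {..a}))" by (rule compact_imp_closed)
    then show ?thesis unfolding eq
      using \<phi>(2) by (auto simp: sets_restrict_space image_iff intro!: bexI[of _ "\<phi> ` (C \<inter> {..a})"])
  qed
  then have "s \<in> borel_measurable (restrict_space borel K)"
    by (simp add: borel_measurable_iff_le)
  with s show ?thesis using that by blast
qed

lemma prob_measures_onD:
  assumes "\<mu> \<in> prob_measures_on K"
  shows "prob_space \<mu>" "sets \<mu> = sets (restrict_space borel K)" "space \<mu> = K"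
  using assms sets_eq_imp_space_eq[of \<mu> "restrict_space borel K"]
  by (auto simp: prob_measures_on_def space_restrict_space)

lemma continuous_measurable_prob_measures_on:
  assumes "\<mu> \<in> prob_measures_on K" "continuous_on K (f :: 'a::topological_space \<Rightarrow> 'b::topological_space)"
  shows "f \<in> borel_measurable \<mu>"
  using borel_measurable_continuous_on_restrict[OF assms(2)] prob_measures_onD(2)[OF assms(1)]
  by (simp cong: measurable_cong_sets)

text \<open>
  The measures are lifted along a Borel section of a continuous map \<open>\<phi>\<close> from a compact set
  \<open>C\<close> of reals onto \<open>K\<close>. Helly's theorem yields a limit of a subsequence on the line; it
  is carried by \<open>C\<close>, and its image under \<open>\<phi>\<close> is the limit on \<open>K\<close>. Although the section
  is not continuous, the lifted integrals of \<open>f \<circ> \<phi>\<close> are those of \<open>f\<close>.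
\<close>
lemma prob_measures_on_sequentially_compact:
  fixes K :: "'a::euclidean_space set"
  assumes K: "compact K" and \<mu>: "\<And>n::nat. \<mu> n \<in> prob_measures_on K"
  shows "\<exists>r \<nu>. strict_mono r \<and> \<nu> \<in> prob_measures_on K \<and>
    (\<forall>f::'a \<Rightarrow> real. continuous_on K f \<longrightarrow> (\<lambda>n. integral\<^sup>L (\<mu> (r n)) f) \<longlonglongrightarrow> integral\<^sup>L \<nu> f)"
proof -
  obtain C :: "real set" and \<phi> :: "real \<Rightarrow> 'a" where C: "compact C" and \<phi>: "continuous_on C \<phi>" "\<phi> ` C = K"
    using compact_continuous_image_of_real_compact[OF K] .
  obtain s where s_meas: "s \<in> borel_measurable (restrict_space borel K)"
    and s: "\<And>x. x \<in> K \<Longrightarrow> s x \<in> C" "\<And>x. x \<in> K \<Longrightarrow> \<phi> (s x) = x"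
    using borel_section_of_real_compact[OF C \<phi>] by blast
  interpret \<mu>: prob_space "\<mu> n" for n using prob_measures_onD(1)[OF \<mu>] .
  have space\<mu>: "space (\<mu> n) = K" for n using prob_measures_onD(3)[OF \<mu>] .
  have [measurable]: "s \<in> borel_measurable (\<mu> n)" for n
    using s_meas prob_measures_onD(2)[OF \<mu>] by (simp cong: measurable_cong_sets)
  obtain x0 where x0: "x0 \<in> K" using \<mu>.not_empty[of 0] space\<mu> by auto
  have Cne: "C \<noteq> {}" using x0 \<phi>(2) by auto
  define M where "M n = distr (\<mu> n) borel s" for n
  have real_M: "real_distribution (M n)" for n
    unfolding M_def by (intro real_distribution.intro \<mu>.prob_space_distr) (auto simp: real_distribution_axioms_def)
  have int_M: "integral\<^sup>L (M n) g = integral\<^sup>L (\<mu> n) (\<lambda>x. g (s x))"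
    if "continuous_on UNIV (g :: real \<Rightarrow> real)" for g n
    unfolding M_def by (rule integral_distr) (use that in \<open>auto intro: borel_measurable_continuous_onI\<close>)
  have "tight M"
    unfolding tight_def
  proof (intro conjI allI impI real_M)
    fix \<epsilon> :: real assume "\<epsilon> > 0"
    obtain b where b: "b > 0" "\<And>t. t \<in> C \<Longrightarrow> \<bar>t\<bar> \<le> b"
      using compact_imp_bounded[OF C] by (auto simp: bounded_pos)
    have "measure (M n) {- b - 1<..b} = 1" for n
    proof -
      have "measure (M n) {- b - 1<..b} = measure (\<mu> n) (s -` {- b - 1<..b} \<inter> space (\<mu> n))"
        unfolding M_def by (rule measure_distr) auto
      also have "s -` {- b - 1<..b} \<inter> space (\<mu> n) = space (\<mu> n)"
        using b(2) s(1) by (force simp: space\<mu>)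
      finally show ?thesis by (simp add: \<mu>.prob_space)
    qed
    then show "\<exists>a b. a < b \<and> (\<forall>n. 1 - \<epsilon> < measure (M n) {a<..b})"
      using \<open>\<epsilon> > 0\<close> b(1) by (intro exI[of _ "- b - 1"] exI[of _ b]) auto
  qed
  then obtain r N where r: "strict_mono r" and N: "real_distribution N" and "weak_conv_m (M \<circ> id \<circ> r) N"
    using tight_imp_convergent_subsubsequence[of M id] by (auto simp: strict_mono_def)
  then have conv: "weak_conv_m (\<lambda>n. M (r n)) N" by (simp add: comp_def)
  interpret N: real_distribution N by (fact N)
  have lim: "(\<lambda>n. integral\<^sup>L (\<mu> (r n)) (\<lambda>x. g (s x))) \<longlonglongrightarrow> integral\<^sup>L N g"
    if g: "continuous_on UNIV g" "\<And>t. norm (g t) \<le> B" for g :: "real \<Rightarrow> real" and B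
  proof -
    have "(\<lambda>n. integral\<^sup>L (M (r n)) g) \<longlonglongrightarrow> integral\<^sup>L N g"
      by (rule weak_conv_imp_integral_bdd_continuous_conv[OF real_M N conv])
         (use g in \<open>auto simp: continuous_on_eq_continuous_at\<close>)
    then show ?thesis by (simp add: int_M[OF g(1)])
  qed
  have inC: "AE t in N. t \<in> C"
  proof -
    \<comment> \<open>The limit is carried by \<open>C\<close>, as the truncated distance to \<open>C\<close> has integral 0.\<close>
    define g where "g t = min 1 (infdist t C)" for t :: real
    have g: "continuous_on UNIV g" unfolding g_def by (intro continuous_intros)
    have gb: "norm (g t) \<le> 1" for t unfolding g_def using infdist_nonneg[of t C] by auto
    have [measurable]: "g \<in> borel_measurable borel" using g by (rule borel_measurable_continuous_onI)
    have "integral\<^sup>L (\<mu> (r n)) (\<lambda>x. g (s x)) = integral\<^sup>L (\<mu> (r n)) (\<lambda>x. 0)" for n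
      by (rule Bochner_Integration.integral_cong) (use s(1) in \<open>auto simp: space\<mu> g_def\<close>)
    then have "integral\<^sup>L N g = 0"
      using lim[OF g gb] by (simp add: LIMSEQ_const_iff)
    moreover have "integrable N g"
      by (rule N.integrable_const_bound[of _ 1]) (use gb in auto)
    moreover have "AE t in N. 0 \<le> g t" by (auto simp: g_def infdist_nonneg)
    ultimately have "AE t in N. g t = 0" using integral_nonneg_eq_0_iff_AE by blast
    then show ?thesis
    proof eventually_elim
      case (elim t)
      then have "infdist t C = 0" unfolding g_def by (simp add: min_def split: if_splits)
      then show ?case using in_closed_iff_infdist_zero[OF compact_imp_closed[OF C] Cne] by blast
    qed
  qed
  \<comment> \<open>Outside \<open>C\<close>, which is a null set for the limit, \<open>\<phi>\<close> may leave \<open>K\<close> or fail to be measurable.\<close>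
  define \<psi> where "\<psi> t = (if t \<in> C then \<phi> t else x0)" for t
  have [measurable]: "C \<in> sets borel" using compact_imp_closed[OF C] by auto
  have "\<psi> \<in> borel_measurable borel"
    unfolding \<psi>_def
    by (subst measurable_If_restrict_space_iff)
       (auto intro!: borel_measurable_continuous_on_restrict[OF \<phi>(1)])
  then have \<psi>: "\<psi> \<in> N \<rightarrow>\<^sub>M restrict_space borel K"
    using \<phi>(2) x0 by (auto intro!: measurable_restrict_space2 simp: \<psi>_def)
  define \<nu> where "\<nu> = distr N (restrict_space borel K) \<psi>"
  have "\<nu> \<in> prob_measures_on K"
    unfolding prob_measures_on_def \<nu>_def using N.prob_space_distr[OF \<psi>] by simp
  moreover have "(\<lambda>n. integral\<^sup>L (\<mu> (r n)) f) \<longlonglongrightarrow> integral\<^sup>L \<nu> f"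
    if f: "continuous_on K f" for f :: "'a \<Rightarrow> real"
  proof -
    have f\<phi>: "continuous_on C (\<lambda>t. f (\<phi> t))"
      by (rule continuous_on_compose2[OF f \<phi>(1)]) (use \<phi>(2) in auto)
    obtain B where B: "\<And>x. x \<in> K \<Longrightarrow> norm (f x) \<le> B"
      using compact_imp_bounded[OF compact_continuous_image[OF f K]] unfolding bounded_iff by auto
    have "0 \<le> B" using B[OF x0] norm_ge_zero order_trans by blast
    \<comment> \<open>Convergence on the line needs a bounded continuous function on all of it.\<close>
    obtain g where g: "continuous_on UNIV g" "\<And>t. t \<in> C \<Longrightarrow> g t = f (\<phi> t)" "\<And>t. norm (g t) \<le> B"
      by (rule Tietze[OF f\<phi>, of UNIV B]) (use B \<phi>(2) \<open>0 \<le> B\<close> compact_imp_closed[OF C] in auto)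
    have [measurable]: "g \<in> borel_measurable borel" using g(1) by (rule borel_measurable_continuous_onI)
    have f\<psi>: "(\<lambda>t. f (\<psi> t)) \<in> borel_measurable N"
      using measurable_compose[OF \<psi> borel_measurable_continuous_on_restrict[OF f]] .
    have "integral\<^sup>L \<nu> f = integral\<^sup>L N (\<lambda>t. f (\<psi> t))"
      unfolding \<nu>_def by (rule integral_distr[OF \<psi> borel_measurable_continuous_on_restrict[OF f]])
    also have "\<dots> = integral\<^sup>L N g"
    proof (rule integral_cong_AE)
      show "AE t in N. f (\<psi> t) = g t" using inC by eventually_elim (simp add: \<psi>_def g(2))
    qed (use f\<psi> in auto)
    finally have "integral\<^sup>L \<nu> f = integral\<^sup>L N g" .
    moreover have "integral\<^sup>L (\<mu> n) (\<lambda>x. g (s x)) = integral\<^sup>L (\<mu> n) f" for n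
      by (rule Bochner_Integration.integral_cong) (auto simp: space\<mu> s g(2))
    ultimately show ?thesis using lim[OF g(1,3)] by simp
  qed
  ultimately show ?thesis using r by blast
qed

section \<open>The Baire property\<close>

text \<open>
  For finite \<open>F\<close> and positive \<open>\<epsilon>\<close> these sets form a basis of neighbourhoods of \<open>\<nu>\<close>.
\<close>
definition weak_ball ::
    "'a::topological_space set \<Rightarrow> ('a \<Rightarrow> real) set \<Rightarrow> real \<Rightarrow> 'a measure \<Rightarrow> 'a measure set" where
  "weak_ball K F \<epsilon> \<nu> =
     {\<mu> \<in> prob_measures_on K. \<forall>f\<in>F. \<bar>integral\<^sup>L \<mu> f - integral\<^sup>L \<nu> f\<bar> < \<epsilon>}"

lemma openin_weak_topology_basic:
  assumes "continuous_on K f" "open U"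
  shows "openin (weak_topology_on K) {\<mu> \<in> prob_measures_on K. integral\<^sup>L \<mu> (f :: _ \<Rightarrow> real) \<in> U}"
  unfolding weak_topology_on_def using assms by (intro topology_generated_by_Basis) auto

lemma openin_weak_topology_finite:
  assumes "finite I" "\<And>i. i \<in> I \<Longrightarrow> continuous_on K (f i)" "\<And>i. i \<in> I \<Longrightarrow> open (U i)"
  shows "openin (weak_topology_on K)
    {\<mu> \<in> prob_measures_on K. \<forall>i\<in>I. integral\<^sup>L \<mu> (f i :: _ \<Rightarrow> real) \<in> U i}"
  using assms
proof (induction I)
  case empty
  show ?case using openin_topspace[of "weak_topology_on K"] by (simp add: topspace_weak_topology_on)
next
  case (insert i I)
  have "{\<mu> \<in> prob_measures_on K. \<forall>i\<in>insert i I. integral\<^sup>L \<mu> (f i) \<in> U i} =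
    {\<mu> \<in> prob_measures_on K. integral\<^sup>L \<mu> (f i) \<in> U i} \<inter>
    {\<mu> \<in> prob_measures_on K. \<forall>i\<in>I. integral\<^sup>L \<mu> (f i) \<in> U i}" by auto
  then show ?case using insert openin_weak_topology_basic[of K "f i" "U i"] by auto
qed

lemma openin_weak_ball:
  assumes "finite F" "\<And>f. f \<in> F \<Longrightarrow> continuous_on K f"
  shows "openin (weak_topology_on K) (weak_ball K F \<epsilon> \<nu>)"
  using openin_weak_topology_finite[of F K "\<lambda>f. f" "\<lambda>f. ball (integral\<^sup>L \<nu> f) \<epsilon>"] assms
  by (simp add: weak_ball_def dist_real_def abs_minus_commute)

lemma weak_open_contains_weak_ball:
  assumes "openin (weak_topology_on K) W" "\<nu> \<in> W"
  obtains F \<epsilon> where "finite F" "\<And>f. f \<in> F \<Longrightarrow> continuous_on K f" "\<epsilon> > 0" "weak_ball K F \<epsilon> \<nu> \<subseteq> W"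
proof -
  have "generate_topology_on {{\<mu> \<in> prob_measures_on K. integral\<^sup>L \<mu> f \<in> U} | f U.
        continuous_on K f \<and> open (U :: real set)} W"
    using assms(1) unfolding weak_topology_on_def by (rule openin_topology_generated_by)
  then have "\<nu> \<in> W \<longrightarrow> (\<exists>F \<epsilon>. finite F \<and> (\<forall>f\<in>F. continuous_on K f) \<and> \<epsilon> > 0 \<and> weak_ball K F \<epsilon> \<nu> \<subseteq> W)"
  proof induction
    case Empty
    then show ?case by simp
  next
    case (Int a b)
    show ?case
    proof
      assume "\<nu> \<in> a \<inter> b"
      then obtain F \<epsilon> F' \<epsilon>' where "finite F" "\<forall>f\<in>F. continuous_on K f" "\<epsilon> > 0" "weak_ball K F \<epsilon> \<nu> \<subseteq> a"
        "finite F'" "\<forall>f\<in>F'. continuous_on K f" "\<epsilon>' > 0" "weak_ball K F' \<epsilon>' \<nu> \<subseteq> b"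
        using Int.IH by auto
      moreover have "weak_ball K (F \<union> F') (min \<epsilon> \<epsilon>') \<nu> \<subseteq> weak_ball K F \<epsilon> \<nu> \<inter> weak_ball K F' \<epsilon>' \<nu>"
        by (auto simp: weak_ball_def)
      ultimately show "\<exists>F \<epsilon>. finite F \<and> (\<forall>f\<in>F. continuous_on K f) \<and> \<epsilon> > 0 \<and> weak_ball K F \<epsilon> \<nu> \<subseteq> a \<inter> b"
        by (intro exI[of _ "F \<union> F'"] exI[of _ "min \<epsilon> \<epsilon>'"]) auto
    qed
  next
    case (UN A)
    then show ?case by (meson Union_iff Union_upper order_trans)
  next
    case (Basis S)
    then obtain f U where S: "S = {\<mu> \<in> prob_measures_on K. integral\<^sup>L \<mu> f \<in> U}" "continuous_on K f" "open (U :: real set)"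
      by auto
    show ?case
    proof
      assume "\<nu> \<in> S"
      then obtain \<epsilon> where "\<epsilon> > 0" "ball (integral\<^sup>L \<nu> f) \<epsilon> \<subseteq> U"
        using S(1,3) by (auto elim: openE)
      then show "\<exists>F \<epsilon>. finite F \<and> (\<forall>f\<in>F. continuous_on K f) \<and> \<epsilon> > 0 \<and> weak_ball K F \<epsilon> \<nu> \<subseteq> S"
        using S by (intro exI[of _ "{f}"] exI[of _ \<epsilon>])
          (auto simp: weak_ball_def dist_real_def abs_minus_commute subset_iff)
    qed
  qed
  then show ?thesis using that assms(2) by blast
qed

text \<open>
  Each neighbourhood is chosen inside the half-size copy of the preceding one. Hence a limit
  of a subsequence of the centres satisfies the defining inequalities of every
  neighbourhood with \<open>\<epsilon>/2\<close> in place of \<open>\<epsilon>\<close>, though possibly without strictness, and so lies in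
  all of them.
\<close>
theorem weak_topology_Baire:
  fixes K :: "'a::euclidean_space set" and G :: "nat \<Rightarrow> 'a measure set"
  assumes K: "compact K"
    and G: "\<And>n. openin (weak_topology_on K) (G n)" "\<And>n. weak_topology_on K closure_of G n = prob_measures_on K"
    and W: "openin (weak_topology_on K) W" "W \<noteq> {}"
  shows "\<exists>\<nu>\<in>W. \<forall>n. \<nu> \<in> G n"
proof -
  let ?X = "weak_topology_on K"
  define valid where "valid x \<longleftrightarrow> (case x of (\<nu>, F, \<epsilon>) \<Rightarrow>
    finite F \<and> (\<forall>f\<in>F. continuous_on K f) \<and> \<epsilon> > 0 \<and> \<nu> \<in> prob_measures_on K)"
    for x :: "'a measure \<times> ('a \<Rightarrow> real) set \<times> real"
  define B where "B x = (case x of (\<nu>, F, \<epsilon>) \<Rightarrow> weak_ball K F \<epsilon> \<nu>)" for x :: "'a measure \<times> ('a \<Rightarrow> real) set \<times> real"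
  define H where "H x = (case x of (\<nu>, F, \<epsilon>) \<Rightarrow> weak_ball K F (\<epsilon>/2) \<nu>)" for x :: "'a measure \<times> ('a \<Rightarrow> real) set \<times> real"
  have inside: "\<exists>x. valid x \<and> B x \<subseteq> V \<inter> G n" if V: "openin ?X V" "V \<noteq> {}" for V n
  proof -
    have "G n \<inter> V \<noteq> {}"
      using G(2)[of n] V dense_intersects_open[of ?X "G n"] topspace_weak_topology_on[of K] by metis
    then obtain \<nu> where \<nu>: "\<nu> \<in> V \<inter> G n" by auto
    have op: "openin ?X (V \<inter> G n)" using V(1) G(1) by (rule openin_Int)
    obtain F \<epsilon> where F: "finite F" "\<And>f. f \<in> F \<Longrightarrow> continuous_on K f" "\<epsilon> > 0" "weak_ball K F \<epsilon> \<nu> \<subseteq> V \<inter> G n"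
      using weak_open_contains_weak_ball[OF op \<nu>] by blast
    moreover have "\<nu> \<in> prob_measures_on K"
      using \<nu> openin_subset[OF op] by (auto simp: topspace_weak_topology_on)
    ultimately show ?thesis by (intro exI[of _ "(\<nu>, F, \<epsilon>)"]) (auto simp: valid_def B_def)
  qed
  have "\<exists>x. \<forall>n. (valid (x n) \<and> B (x n) \<subseteq> W \<inter> G n) \<and> B (x (Suc n)) \<subseteq> H (x n)"
  proof (rule dependent_nat_choice)
    show "\<exists>x. valid x \<and> B x \<subseteq> W \<inter> G 0" using inside[OF W] .
  next
    fix x n assume x: "valid x \<and> B x \<subseteq> W \<inter> G n"
    obtain \<nu> F \<epsilon> where x_eq: "x = (\<nu>, F, \<epsilon>)" by (cases x)
    have "openin ?X (H x)" using x by (auto simp: x_eq H_def valid_def intro: openin_weak_ball)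
    moreover have "\<nu> \<in> H x" using x by (auto simp: x_eq H_def valid_def weak_ball_def)
    moreover have "H x \<subseteq> B x" using x by (force simp: x_eq H_def B_def valid_def weak_ball_def)
    ultimately show "\<exists>y. (valid y \<and> B y \<subseteq> W \<inter> G (Suc n)) \<and> B y \<subseteq> H x"
      using inside[of "H x" "Suc n"] x by blast
  qed
  then obtain x where x: "\<And>n. valid (x n)" "\<And>n. B (x n) \<subseteq> W \<inter> G n" "\<And>n. B (x (Suc n)) \<subseteq> H (x n)" by blast
  have HB: "H (x n) \<subseteq> B (x n)" for n
    using x(1)[of n] by (cases "x n") (force simp: H_def B_def valid_def weak_ball_def)
  have anti: "B (x n) \<subseteq> B (x m)" if "m \<le> n" for m n
    using that by (induction rule: dec_induct) (use x(3) HB in blast)+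
  have nest: "B (x n) \<subseteq> H (x m)" if "m < n" for m n
    using anti[of "Suc m" n] x(3)[of m] that by auto
  define \<nu> where "\<nu> n = fst (x n)" for n
  have \<nu>: "\<nu> n \<in> prob_measures_on K" "\<nu> n \<in> B (x n)" for n
    using x(1)[of n] by (auto simp: \<nu>_def valid_def B_def weak_ball_def split: prod.splits)
  obtain r \<mu> where r: "strict_mono r" and \<mu>: "\<mu> \<in> prob_measures_on K"
    and lim: "\<forall>f::'a \<Rightarrow> real. continuous_on K f \<longrightarrow> (\<lambda>n. integral\<^sup>L (\<nu> (r n)) f) \<longlonglongrightarrow> integral\<^sup>L \<mu> f"
    using prob_measures_on_sequentially_compact[of K \<nu>, OF K \<nu>(1)] by (elim exE conjE) (erule (2) that)
  have "\<mu> \<in> B (x m)" for m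
  proof -
    obtain F \<epsilon> where x_eq: "x m = (\<nu> m, F, \<epsilon>)" by (cases "x m") (auto simp: \<nu>_def)
    have val: "\<epsilon> > 0" "\<And>f. f \<in> F \<Longrightarrow> continuous_on K f" using x(1)[of m] by (auto simp: x_eq valid_def)
    have "\<bar>integral\<^sup>L \<mu> f - integral\<^sup>L (\<nu> m) f\<bar> < \<epsilon>" if f: "f \<in> F" for f
    proof -
      have "\<forall>\<^sub>F n in sequentially. \<bar>integral\<^sup>L (\<nu> (r n)) f - integral\<^sup>L (\<nu> m) f\<bar> \<le> \<epsilon>/2"
        using eventually_gt_at_top[of m]
      proof eventually_elim
        case (elim n)
        then have "m < r n" using seq_suble[OF r, of n] by linarith
        then have "\<nu> (r n) \<in> H (x m)" using nest \<nu>(2) by blast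
        then show ?case using f by (auto simp: H_def x_eq weak_ball_def intro: less_imp_le)
      qed
      moreover have "(\<lambda>n. \<bar>integral\<^sup>L (\<nu> (r n)) f - integral\<^sup>L (\<nu> m) f\<bar>) \<longlonglongrightarrow> \<bar>integral\<^sup>L \<mu> f - integral\<^sup>L (\<nu> m) f\<bar>"
        by (intro tendsto_intros lim[rule_format] val(2) f)
      ultimately have "\<bar>integral\<^sup>L \<mu> f - integral\<^sup>L (\<nu> m) f\<bar> \<le> \<epsilon>/2"
        by (intro tendsto_upperbound[of _ _ sequentially]) auto
      then show ?thesis using val(1) by linarith
    qed
    then show ?thesis using \<mu> by (auto simp: B_def x_eq weak_ball_def)
  qed
  then show ?thesis using x(2) by blast
qed

text \<open>
  Equivalently, the union of all open sets on which \<open>Q\<close> holds is dense. The local form is the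
  one that gets verified, by perturbing a given open set.
\<close>
definition holds_on_dense_open :: "'b topology \<Rightarrow> ('b \<Rightarrow> bool) \<Rightarrow> bool" where
  "holds_on_dense_open X Q \<longleftrightarrow>
     (\<forall>W. openin X W \<and> W \<noteq> {} \<longrightarrow> (\<exists>W'. openin X W' \<and> W' \<noteq> {} \<and> W' \<subseteq> W \<and> (\<forall>\<mu>\<in>W'. Q \<mu>)))"

lemma typical_in_weak_topology_countable:
  fixes K :: "'a::euclidean_space set"
  assumes K: "compact K" and count: "countable \<Q>"
    and gen: "\<And>Q. Q \<in> \<Q> \<Longrightarrow> holds_on_dense_open (weak_topology_on K) Q"
  shows "typical_in (weak_topology_on K) (\<lambda>\<mu>. \<forall>Q\<in>\<Q>. Q \<mu>)"
proof -
  let ?X = "weak_topology_on K"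
  define S where "S Q = \<Union>{W. openin ?X W \<and> (\<forall>\<mu>\<in>W. Q \<mu>)}" for Q
  \<comment> \<open>The trivial property makes the family nonempty, so that it can be enumerated.\<close>
  define \<Q>' where "\<Q>' = insert (\<lambda>_. True) \<Q>"
  have open_S: "openin ?X (S Q)" for Q unfolding S_def by (rule openin_Union) auto
  have dense_S: "?X closure_of S Q = prob_measures_on K" if "Q \<in> \<Q>'" for Q
  proof -
    have "holds_on_dense_open ?X Q"
      using that gen unfolding \<Q>'_def holds_on_dense_open_def by auto
    have "S Q \<inter> T \<noteq> {}" if T: "openin ?X T" "T \<noteq> {}" for T
    proof -
      obtain W' where W': "openin ?X W'" "W' \<noteq> {}" "W' \<subseteq> T" "\<forall>\<mu>\<in>W'. Q \<mu>"
        using \<open>holds_on_dense_open ?X Q\<close> T unfolding holds_on_dense_open_def by metis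
      then have "W' \<subseteq> S Q" unfolding S_def by (intro Union_upper) simp
      then show ?thesis using W' by auto
    qed
    then show ?thesis
      using dense_intersects_open[of ?X "S Q"] topspace_weak_topology_on[of K] by metis
  qed
  define G where "G = (\<Inter>Q\<in>\<Q>'. S Q)"
  have \<Q>': "countable \<Q>'" "\<Q>' \<noteq> {}" using count by (auto simp: \<Q>'_def)
  have "gdelta_in ?X G"
    unfolding G_def using \<Q>' by (intro gdelta_in_Inter) (auto intro: open_imp_gdelta_in open_S)
  moreover have "?X closure_of G = topspace ?X"
    unfolding dense_intersects_open
  proof (intro allI impI, elim conjE)
    fix T assume T: "openin ?X T" "T \<noteq> {}"
    have "\<exists>\<nu>\<in>T. \<forall>n. \<nu> \<in> S (from_nat_into \<Q>' n)"
      using \<Q>' by (intro weak_topology_Baire[OF K open_S _ T] dense_S from_nat_into) auto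
    then show "G \<inter> T \<noteq> {}"
      using from_nat_into_surj[OF \<Q>'(1)] unfolding G_def by fastforce
  qed
  moreover have "\<forall>\<mu>\<in>G. \<forall>Q\<in>\<Q>. Q \<mu>"
    unfolding G_def S_def \<Q>'_def by blast
  ultimately show ?thesis unfolding typical_in_def by blast
qed

section \<open>Finitely supported measures\<close>

text \<open>
  A probability mass function measures all subsets of the type; only the Borel subsets of
  \<open>K\<close> are kept.
\<close>
definition pmf_measure_on :: "'a::topological_space set \<Rightarrow> 'a pmf \<Rightarrow> 'a measure" where
  "pmf_measure_on K p = distr (restrict_space (measure_pmf p) K) (restrict_space borel K) (\<lambda>x. x)"

lemma measurable_pmf_measure_on [measurable]:
  "(\<lambda>x. x) \<in> restrict_space (measure_pmf p) K \<rightarrow>\<^sub>M restrict_space borel K"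
  by (intro measurable_restrict_space3) auto

lemma pmf_measure_on_prob:
  assumes "set_pmf p \<subseteq> K"
  shows "pmf_measure_on K p \<in> prob_measures_on K"
proof -
  have "emeasure (measure_pmf p) K = 1"
    using assms by (subst measure_pmf.emeasure_eq_1_AE) (auto simp: AE_measure_pmf_iff)
  then have "prob_space (restrict_space (measure_pmf p) K)"
    by (intro prob_space_restrict_space) auto
  then show ?thesis
    unfolding prob_measures_on_def pmf_measure_on_def
    by (auto intro!: prob_space.prob_space_distr)
qed

lemma integral_pmf_measure_on:
  assumes "set_pmf p \<subseteq> K" "continuous_on K f"
  shows "integral\<^sup>L (pmf_measure_on K p) f = measure_pmf.expectation p (f :: _ \<Rightarrow> real)"
proof -
  have "integral\<^sup>L (pmf_measure_on K p) f = integral\<^sup>L (restrict_space (measure_pmf p) K) f"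
    unfolding pmf_measure_on_def
    by (rule integral_distr[OF measurable_pmf_measure_on borel_measurable_continuous_on_restrict[OF assms(2)]])
  also have "\<dots> = (\<integral>x. indicator K x *\<^sub>R f x \<partial>measure_pmf p)"
    by (rule integral_restrict_space) auto
  also have "\<dots> = measure_pmf.expectation p f"
    by (rule integral_cong_AE) (use assms in \<open>auto simp: AE_measure_pmf_iff\<close>)
  finally show ?thesis .
qed

lemma expectation_pmf_close:
  fixes f :: "'a \<Rightarrow> real"
  assumes "finite (set_pmf p)" "\<And>y. y \<in> set_pmf p \<Longrightarrow> \<bar>f y - c\<bar> \<le> e"
  shows "\<bar>measure_pmf.expectation p f - c\<bar> \<le> e"
proof -
  have int: "integrable (measure_pmf p) f" using assms(1) by (rule integrable_measure_pmf_finite)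
  have "f y \<le> c + e \<and> c - e \<le> f y" if "y \<in> set_pmf p" for y using assms(2)[OF that] by linarith
  then have "measure_pmf.expectation p f \<le> c + e" "c - e \<le> measure_pmf.expectation p f"
    using int by (auto intro!: measure_pmf.integral_le_const measure_pmf.integral_ge_const simp: AE_measure_pmf_iff)
  then show ?thesis by linarith
qed

text \<open>
  Spreading every atom \<open>z\<close> according to \<open>k z\<close> changes integrals by no more than the oscillation of
  the integrand at the scale of the spreading.
\<close>
lemma expectation_bind_pmf_close:
  fixes f :: "'a \<Rightarrow> real"
  assumes fin: "finite (set_pmf p)" "\<And>z. z \<in> set_pmf p \<Longrightarrow> finite (set_pmf (k z))"
    and close: "\<And>z y. z \<in> set_pmf p \<Longrightarrow> y \<in> set_pmf (k z) \<Longrightarrow> \<bar>f y - f z\<bar> \<le> e"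
  shows "\<bar>measure_pmf.expectation (bind_pmf p k) f - measure_pmf.expectation p f\<bar> \<le> e"
proof -
  have e1: "measure_pmf.expectation (bind_pmf p k) f =
      (\<Sum>z\<in>set_pmf p. pmf p z *\<^sub>R measure_pmf.expectation (k z) f)"
    by (rule pmf_expectation_bind) (use fin in auto)
  have e2: "measure_pmf.expectation p f = (\<Sum>z\<in>set_pmf p. pmf p z *\<^sub>R f z)"
    by (rule integral_measure_pmf) (use fin in auto)
  have "\<bar>measure_pmf.expectation (bind_pmf p k) f - measure_pmf.expectation p f\<bar> =
      \<bar>\<Sum>z\<in>set_pmf p. pmf p z * (measure_pmf.expectation (k z) f - f z)\<bar>"
    by (simp add: e1 e2 sum_subtractf algebra_simps)
  also have "\<dots> \<le> (\<Sum>z\<in>set_pmf p. pmf p z * \<bar>measure_pmf.expectation (k z) f - f z\<bar>)"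
    by (rule order_trans[OF sum_abs]) (simp add: abs_mult)
  also have "\<dots> \<le> (\<Sum>z\<in>set_pmf p. pmf p z * e)"
    by (intro sum_mono mult_left_mono expectation_pmf_close fin close) auto
  also have "\<dots> = e"
    using fin by (simp add: sum_distrib_right[symmetric] sum_pmf_eq_1)
  finally show ?thesis .
qed

text \<open>
  A finite net of \<open>K\<close> is enumerated, and every point of \<open>K\<close> is moved to the first point of
  the net at distance less than \<open>\<rho>\<close>. The image of \<open>\<nu>\<close> under this map is the measure sought.
\<close>
lemma discretize_measure:
  fixes K :: "'a::euclidean_space set"
  assumes K: "compact K" and \<nu>: "\<nu> \<in> prob_measures_on K" and "\<rho> > 0"
  shows "\<exists>p. finite (set_pmf p) \<and> set_pmf p \<subseteq> K \<and>
    (\<forall>f e. continuous_on K f \<longrightarrow> (\<forall>x\<in>K. \<forall>y\<in>K. dist x y < \<rho> \<longrightarrow> \<bar>f x - f y\<bar> \<le> e) \<longrightarrow>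
       \<bar>measure_pmf.expectation p f - integral\<^sup>L \<nu> (f :: 'a \<Rightarrow> real)\<bar> \<le> e)"
proof -
  interpret \<nu>: prob_space \<nu> using prob_measures_onD(1)[OF \<nu>] .
  have space\<nu>: "space \<nu> = K" using prob_measures_onD(3)[OF \<nu>] .
  obtain Z where Z: "finite Z" "Z \<subseteq> K" "K \<subseteq> (\<Union>z\<in>Z. ball z \<rho>)"
    by (rule compactE_image[OF K, of K "\<lambda>z. ball z \<rho>"]) (use \<open>\<rho> > 0\<close> in auto)
  have "Z \<noteq> {}" using Z(3) \<nu>.not_empty space\<nu> by auto
  define z where "z = from_nat_into Z"
  have zZ: "z i \<in> Z" for i unfolding z_def by (rule from_nat_into[OF \<open>Z \<noteq> {}\<close>])
  define g where "g x = z (LEAST i. dist (z i) x < \<rho>)" for x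
  have [measurable]: "(\<lambda>x. x) \<in> borel_measurable \<nu>"
    by (rule continuous_measurable_prob_measures_on[OF \<nu>]) simp
  have "(\<lambda>x. LEAST i. dist (z i) x < \<rho>) \<in> \<nu> \<rightarrow>\<^sub>M count_space UNIV" by measurable
  then have g_meas: "g \<in> \<nu> \<rightarrow>\<^sub>M count_space UNIV"
    unfolding g_def by (rule measurable_compose) simp
  have g: "g x \<in> K" "dist (g x) x < \<rho>" if x: "x \<in> K" for x
  proof -
    obtain y where "y \<in> Z" and y: "dist y x < \<rho>" using Z(3) x by auto
    obtain i where i: "z i = y"
      using from_nat_into_surj[OF countable_finite[OF Z(1)] \<open>y \<in> Z\<close>] unfolding z_def by auto
    show "dist (g x) x < \<rho>"
      unfolding g_def by (rule LeastI[of "\<lambda>i. dist (z i) x < \<rho>" i]) (simp add: i y)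
    show "g x \<in> K" unfolding g_def by (rule subsetD[OF Z(2) zZ])
  qed
  define M where "M = distr \<nu> (count_space UNIV) g"
  interpret M: prob_space M unfolding M_def by (rule \<nu>.prob_space_distr[OF g_meas])
  have sets_M: "sets M = UNIV" by (simp add: M_def)
  have AE_Z: "AE y in M. y \<in> Z"
    unfolding M_def by (subst AE_distr_iff[OF g_meas]) (auto simp: g_def zZ)
  then have "AE y in M. measure M {y} \<noteq> 0"
    using M.AE_support_countable[OF sets_M] countable_finite[OF Z(1)] by blast
  then have pM: "measure_pmf (Abs_pmf M) = M"
    by (intro Abs_pmf_inverse) (auto simp: sets_M M.prob_space_axioms)
  have sub: "set_pmf (Abs_pmf M) \<subseteq> Z" 
  proof -
    have "AE y in measure_pmf (Abs_pmf M). y \<in> Z" unfolding pM by (rule AE_Z)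
    then show ?thesis by (simp add: AE_measure_pmf_iff subset_iff)
  qed
  show ?thesis
  proof (intro exI[of _ "Abs_pmf M"] conjI allI impI)
    show "finite (set_pmf (Abs_pmf M))" "set_pmf (Abs_pmf M) \<subseteq> K"
      using sub Z finite_subset by auto
    fix f :: "'a \<Rightarrow> real" and e
    assume f: "continuous_on K f" and close: "\<forall>x\<in>K. \<forall>y\<in>K. dist x y < \<rho> \<longrightarrow> \<bar>f x - f y\<bar> \<le> e"
    have [measurable]: "f \<in> borel_measurable \<nu>" by (rule continuous_measurable_prob_measures_on[OF \<nu> f])
    have fg[measurable]: "(\<lambda>x. f (g x)) \<in> borel_measurable \<nu>" using g_meas by (rule measurable_compose) simp
    obtain C where C: "\<And>x. x \<in> K \<Longrightarrow> \<bar>f x\<bar> \<le> C"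
      using compact_imp_bounded[OF compact_continuous_image[OF f K]] unfolding bounded_iff by auto
    have int: "integrable \<nu> f" "integrable \<nu> (\<lambda>x. f (g x))"
      using C g by (auto intro!: \<nu>.integrable_const_bound[of _ C] simp: space\<nu>)
    have "measure_pmf.expectation (Abs_pmf M) f = integral\<^sup>L \<nu> (\<lambda>x. f (g x))"
      unfolding pM unfolding M_def by (rule integral_distr[OF g_meas]) simp
    then have "measure_pmf.expectation (Abs_pmf M) f - integral\<^sup>L \<nu> f = integral\<^sup>L \<nu> (\<lambda>x. f (g x) - f x)"
      using int by simp
    moreover have "\<bar>f (g x) - f x\<bar> \<le> e" if "x \<in> K" for x using close g[OF that] that by blast
    then have "f (g x) - f x \<le> e \<and> - e \<le> f (g x) - f x" if "x \<in> K" for x using that by (meson abs_le_D1 abs_le_D2 minus_le_iff)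
    then have "integral\<^sup>L \<nu> (\<lambda>x. f (g x) - f x) \<le> e" "- e \<le> integral\<^sup>L \<nu> (\<lambda>x. f (g x) - f x)"
      using int by (auto intro!: \<nu>.integral_le_const \<nu>.integral_ge_const simp: space\<nu> simp del: Bochner_Integration.integral_diff)
    ultimately show "\<bar>measure_pmf.expectation (Abs_pmf M) f - integral\<^sup>L \<nu> f\<bar> \<le> e" by linarith
  qed
qed

lemma finite_family_uniformly_continuous:
  fixes K :: "'a::metric_space set"
  assumes "compact K" "finite F" "\<And>f. f \<in> F \<Longrightarrow> continuous_on K (f :: 'a \<Rightarrow> real)" "e > 0"
  shows "\<exists>\<rho>>0. \<forall>f\<in>F. \<forall>x\<in>K. \<forall>y\<in>K. dist x y < \<rho> \<longrightarrow> \<bar>f x - f y\<bar> \<le> e"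
  using assms(2,3)
proof (induction F)
  case empty
  then show ?case by (intro exI[of _ 1]) auto
next
  case (insert f F)
  then obtain \<rho> where \<rho>: "\<rho> > 0" "\<forall>f\<in>F. \<forall>x\<in>K. \<forall>y\<in>K. dist x y < \<rho> \<longrightarrow> \<bar>f x - f y\<bar> \<le> e" by auto
  have "uniformly_continuous_on K f"
    using insert.prems assms(1) by (intro compact_uniformly_continuous) auto
  then obtain \<rho>' where \<rho>': "\<rho>' > 0" "\<forall>x\<in>K. \<forall>y\<in>K. dist y x < \<rho>' \<longrightarrow> dist (f y) (f x) < e"
    using \<open>e > 0\<close> unfolding uniformly_continuous_on_def by metis
  show ?case
  proof (intro exI[of _ "min \<rho> \<rho>'"] conjI ballI impI)
    fix g x y assume g: "g \<in> insert f F" and xy: "x \<in> K" "y \<in> K" "dist x y < min \<rho> \<rho>'"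
    show "\<bar>g x - g y\<bar> \<le> e"
    proof (cases "g = f")
      case True
      have "dist (f x) (f y) < e" using \<rho>'(2) xy by auto
      then show ?thesis using True by (simp add: dist_real_def)
    next
      case False
      then show ?thesis using \<rho>(2) g xy by auto
    qed
  qed (use \<rho>(1) \<rho>'(1) in auto)
qed

text \<open>
  An atom of small mass \<open>\<eta>\<close> at the prescribed point \<open>x\<close> is added to a discretization, and \<open>\<rho>\<close> is a
  scale at which the finitely many test functions of a basic neighbourhood are almost constant. The
  added atom, the spreading and the discretization each cost at most \<open>\<epsilon>/4\<close>.
\<close>
lemma weak_open_contains_spread_pmf:
  fixes K :: "'a::euclidean_space set"
  assumes K: "compact K" and W: "openin (weak_topology_on K) W" "W \<noteq> {}" and x: "x \<in> K"
  obtains p \<rho> where "finite (set_pmf p)" "set_pmf p \<subseteq> K" "x \<in> set_pmf p" "\<rho> > 0"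
    "\<And>k. (\<And>z. z \<in> set_pmf p \<Longrightarrow> finite (set_pmf (k z)) \<and> set_pmf (k z) \<subseteq> K \<inter> ball z \<rho>) \<Longrightarrow>
       pmf_measure_on K (bind_pmf p k) \<in> W"
proof -
  obtain \<nu> where "\<nu> \<in> W" using W(2) by auto
  then have \<nu>: "\<nu> \<in> prob_measures_on K" using openin_subset[OF W(1)] by (auto simp: topspace_weak_topology_on)
  obtain F \<epsilon> where F: "finite F" "\<And>f. f \<in> F \<Longrightarrow> continuous_on K f" and "\<epsilon> > 0" and sub: "weak_ball K F \<epsilon> \<nu> \<subseteq> W"
    using weak_open_contains_weak_ball[OF W(1) \<open>\<nu> \<in> W\<close>] by blast
  obtain \<rho> where "\<rho> > 0" and \<rho>: "\<And>f x y. f \<in> F \<Longrightarrow> x \<in> K \<Longrightarrow> y \<in> K \<Longrightarrow> dist x y < \<rho> \<Longrightarrow> \<bar>f x - f y\<bar> \<le> \<epsilon>/4"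
    using finite_family_uniformly_continuous[OF K F, of "\<epsilon>/4"] \<open>\<epsilon> > 0\<close> by auto
  obtain p0 where p0: "finite (set_pmf p0)" "set_pmf p0 \<subseteq> K"
    and p0_close: "\<forall>f e. continuous_on K f \<longrightarrow> (\<forall>x\<in>K. \<forall>y\<in>K. dist x y < \<rho> \<longrightarrow> \<bar>f x - f y\<bar> \<le> e) \<longrightarrow>
       \<bar>measure_pmf.expectation p0 f - integral\<^sup>L \<nu> (f :: 'a \<Rightarrow> real)\<bar> \<le> e"
    using discretize_measure[OF K \<nu> \<open>\<rho> > 0\<close>] by (elim exE conjE) (erule (2) that)
  define M where "M = 1 + (\<Sum>f\<in>F. SUP x\<in>K. \<bar>f x\<bar>)"
  have bdd: "bdd_above ((\<lambda>x. \<bar>f x\<bar>) ` K)" if "f \<in> F" for f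
    using compact_imp_bounded[OF compact_continuous_image[OF F(2)[OF that] K]]
    by (auto simp: bounded_iff bdd_above_def)
  have SUP_nonneg: "0 \<le> (SUP x\<in>K. \<bar>f x\<bar>)" if "f \<in> F" for f
    using cSUP_upper[OF x bdd[OF that]] by (rule order_trans[rotated]) simp
  have M: "\<bar>f y\<bar> \<le> M" if "f \<in> F" "y \<in> K" for f y
  proof -
    have "\<bar>f y\<bar> \<le> (SUP x\<in>K. \<bar>f x\<bar>)" using cSUP_upper[OF that(2) bdd[OF that(1)]] .
    also have "\<dots> \<le> (\<Sum>f\<in>F. SUP x\<in>K. \<bar>f x\<bar>)"
      using F(1) that(1) SUP_nonneg by (intro member_le_sum) auto
    finally show ?thesis unfolding M_def by simp
  qed
  have "M > 0" unfolding M_def using SUP_nonneg by (smt (verit) sum_nonneg)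
  define \<eta> where "\<eta> = min (1/2) (\<epsilon> / (8 * M))"
  have \<eta>: "0 < \<eta>" "\<eta> < 1" "2 * M * \<eta> \<le> \<epsilon>/4"
    using \<open>\<epsilon> > 0\<close> \<open>M > 0\<close> by (auto simp: \<eta>_def min_def field_simps)
  define p where "p = bind_pmf (bernoulli_pmf \<eta>) (\<lambda>b. if b then return_pmf x else p0)"
  have set_p: "set_pmf p = insert x (set_pmf p0)" using \<eta> by (auto simp: p_def set_bind_pmf set_pmf_bernoulli split: if_splits)
  have E_p: "measure_pmf.expectation p f = \<eta> * f x + (1 - \<eta>) * measure_pmf.expectation p0 f" for f :: "'a \<Rightarrow> real"
    unfolding p_def using p0(1) \<eta> by (subst pmf_expectation_bind[of UNIV]) (auto simp: UNIV_bool)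
  show ?thesis
  proof
    show "finite (set_pmf p)" "set_pmf p \<subseteq> K" "x \<in> set_pmf p" "\<rho> > 0"
      using set_p p0 x \<open>\<rho> > 0\<close> by auto
    fix k assume k: "\<And>z. z \<in> set_pmf p \<Longrightarrow> finite (set_pmf (k z)) \<and> set_pmf (k z) \<subseteq> K \<inter> ball z \<rho>"
    have supp: "set_pmf (bind_pmf p k) \<subseteq> K" using k by auto
    have "\<bar>integral\<^sup>L (pmf_measure_on K (bind_pmf p k)) f - integral\<^sup>L \<nu> f\<bar> < \<epsilon>" if f: "f \<in> F" for f
    proof -
      have "\<bar>measure_pmf.expectation (bind_pmf p k) f - measure_pmf.expectation p f\<bar> \<le> \<epsilon>/4"
      proof (rule expectation_bind_pmf_close)
        fix z y assume z: "z \<in> set_pmf p" "y \<in> set_pmf (k z)"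
        then have "z \<in> K" "y \<in> K" "dist y z < \<rho>" using k[OF z(1)] set_p p0 x by (auto simp: dist_commute)
        then show "\<bar>f y - f z\<bar> \<le> \<epsilon>/4" using \<rho>[OF f] by auto
      qed (use k set_p p0 in auto)
      moreover have "\<bar>measure_pmf.expectation p f - measure_pmf.expectation p0 f\<bar> \<le> \<epsilon>/4"
      proof -
        have "\<bar>measure_pmf.expectation p0 f - 0\<bar> \<le> M"
          by (rule expectation_pmf_close) (use p0 M[OF f] in auto)
        then have "\<bar>f x - measure_pmf.expectation p0 f\<bar> \<le> 2 * M" using M[OF f x] by linarith
        then have "\<eta> * \<bar>f x - measure_pmf.expectation p0 f\<bar> \<le> \<eta> * (2 * M)" using \<eta> by (intro mult_left_mono) auto
        moreover have "measure_pmf.expectation p f - measure_pmf.expectation p0 f = \<eta> * (f x - measure_pmf.expectation p0 f)"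
          unfolding E_p by (simp add: algebra_simps)
        then have "\<bar>measure_pmf.expectation p f - measure_pmf.expectation p0 f\<bar> = \<eta> * \<bar>f x - measure_pmf.expectation p0 f\<bar>"
          using \<eta> by (simp add: abs_mult)
        moreover have "\<eta> * (2 * M) = 2 * M * \<eta>" by simp
        ultimately show ?thesis using \<eta>(3) by linarith
      qed
      moreover have "\<bar>measure_pmf.expectation p0 f - integral\<^sup>L \<nu> f\<bar> \<le> \<epsilon>/4"
        using p0_close F(2)[OF f] \<rho>[OF f] by blast
      ultimately show ?thesis
        unfolding integral_pmf_measure_on[OF supp F(2)[OF f]] using \<open>\<epsilon> > 0\<close> by linarith
    qed
    then have "pmf_measure_on K (bind_pmf p k) \<in> weak_ball K F \<epsilon> \<nu>"
      using pmf_measure_on_prob[OF supp] by (auto simp: weak_ball_def)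
    then show "pmf_measure_on K (bind_pmf p k) \<in> W" using sub by auto
  qed
qed

section \<open>Generic properties\<close>

lemma Int_measurable_prob_measures_on:
  assumes "\<mu> \<in> prob_measures_on K" "A \<in> sets borel"
  shows "K \<inter> A \<in> sets \<mu>"
  using assms by (auto simp: prob_measures_onD(2) sets_restrict_space)

lemma bump_function:
  fixes S T :: "'a::euclidean_space set"
  assumes "closed S" "open T" "S \<subseteq> T"
  obtains f :: "'a \<Rightarrow> real" where "continuous_on UNIV f" "\<And>x. 0 \<le> f x" "\<And>x. f x \<le> 1"
    "\<And>x. x \<in> S \<Longrightarrow> f x = 1" "\<And>x. x \<notin> T \<Longrightarrow> f x = 0"
proof -
  obtain f :: "'a \<Rightarrow> real" where f: "continuous_on UNIV f" "\<And>x. f x \<in> closed_segment 1 0"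
    "\<And>x. x \<in> S \<Longrightarrow> f x = 1" "\<And>x. x \<in> - T \<Longrightarrow> f x = 0"
    by (rule Urysohn[of S "- T" 1 0]) (use assms in auto)
  have "0 \<le> f x \<and> f x \<le> 1" for x using f(2)[of x] by (simp add: closed_segment_eq_real_ivl)
  then show ?thesis using f that by auto
qed

lemma integral_le_measure:
  fixes f :: "'a::topological_space \<Rightarrow> real"
  assumes \<mu>: "\<mu> \<in> prob_measures_on K" and f: "continuous_on K f" and A: "A \<in> sets \<mu>"
    and bd: "\<And>x. 0 \<le> f x" "\<And>x. f x \<le> 1" and zero: "\<And>x. x \<in> K \<Longrightarrow> x \<notin> A \<Longrightarrow> f x = 0"
  shows "integral\<^sup>L \<mu> f \<le> measure \<mu> A"
proof -
  interpret prob_space \<mu> using prob_measures_onD(1)[OF \<mu>] .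
  have [measurable]: "f \<in> borel_measurable \<mu>" by (rule continuous_measurable_prob_measures_on[OF \<mu> f])
  have "integrable \<mu> f" by (rule integrable_const_bound[of _ 1]) (use bd in auto)
  moreover have "integrable \<mu> (indicator A :: _ \<Rightarrow> real)"
    by (rule integrable_const_bound[of _ 1]) (use A in auto)
  ultimately have "integral\<^sup>L \<mu> f \<le> integral\<^sup>L \<mu> (indicator A)"
    using zero bd prob_measures_onD(3)[OF \<mu>] by (intro integral_mono) (auto simp: indicator_def)
  then show ?thesis using A sets.sets_into_space[OF A] by (simp add: Int_absorb2)
qed

lemma weak_open_nonempty_carrier:
  assumes "openin (weak_topology_on K) W" "W \<noteq> {}"
  shows "K \<noteq> {}"
proof -
  obtain \<mu> where "\<mu> \<in> prob_measures_on K"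
    using assms openin_subset[OF assms(1)] by (auto simp: topspace_weak_topology_on)
  then show ?thesis using prob_measures_onD(1,3) prob_space.not_empty by metis
qed

text \<open>
  The condition that a bump function around \<open>x\<close> has positive integral is open, and a measure with an
  atom at \<open>x\<close> meets it.
\<close>
lemma dense_open_ball_positive:
  fixes K :: "'a::euclidean_space set"
  assumes K: "compact K" and x: "x \<in> K" and r: "r > 0"
  shows "holds_on_dense_open (weak_topology_on K) (\<lambda>\<mu>. 0 < measure \<mu> (K \<inter> ball x r))"
  unfolding holds_on_dense_open_def
proof (intro allI impI, elim conjE)
  fix W assume W: "openin (weak_topology_on K) W" "W \<noteq> {}"
  obtain f :: "'a \<Rightarrow> real" where f: "continuous_on UNIV f" "\<And>y. 0 \<le> f y" "\<And>y. f y \<le> 1"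
    "\<And>y. y \<in> {x} \<Longrightarrow> f y = 1" "\<And>y. y \<notin> ball x r \<Longrightarrow> f y = 0"
    by (rule bump_function[of "{x}" "ball x r"]) (use r in auto)
  have fK: "continuous_on K f" using f(1) continuous_on_subset by blast
  obtain p \<rho> where p: "finite (set_pmf p)" "set_pmf p \<subseteq> K" "x \<in> set_pmf p" "\<rho> > 0"
    and inW: "\<And>k. (\<And>z. z \<in> set_pmf p \<Longrightarrow> finite (set_pmf (k z)) \<and> set_pmf (k z) \<subseteq> K \<inter> ball z \<rho>) \<Longrightarrow>
       pmf_measure_on K (bind_pmf p k) \<in> W"
    using weak_open_contains_spread_pmf[OF K W x] by blast
  have \<mu>0: "pmf_measure_on K p \<in> W"
    using inW[of return_pmf] p by (auto simp: bind_return_pmf')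
  have "0 < measure_pmf.expectation p f"
  proof -
    have "0 < pmf p x" using p(3) by (simp add: pmf_positive)
    also have "pmf p x = measure_pmf.expectation p (indicator {x})" by (simp add: measure_pmf_single)
    also have "\<dots> \<le> measure_pmf.expectation p f"
      using p(1) f by (intro integral_mono integrable_measure_pmf_finite) (auto simp: indicator_def)
    finally show ?thesis .
  qed
  then have pos: "0 < integral\<^sup>L (pmf_measure_on K p) f" by (simp add: integral_pmf_measure_on[OF p(2) fK])
  define W' where "W' = W \<inter> {\<mu> \<in> prob_measures_on K. integral\<^sup>L \<mu> f \<in> {0<..}}"
  have "openin (weak_topology_on K) W'"
    unfolding W'_def by (intro openin_Int W openin_weak_topology_basic fK) auto
  moreover have "pmf_measure_on K p \<in> W'"
    using \<mu>0 pos pmf_measure_on_prob[OF p(2)] by (simp add: W'_def)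
  moreover have "0 < measure \<mu> (K \<inter> ball x r)" if "\<mu> \<in> W'" for \<mu>
  proof -
    have \<mu>: "\<mu> \<in> prob_measures_on K" "0 < integral\<^sup>L \<mu> f" using that by (auto simp: W'_def)
    have "integral\<^sup>L \<mu> f \<le> measure \<mu> (K \<inter> ball x r)"
      by (rule integral_le_measure[OF \<mu>(1) fK Int_measurable_prob_measures_on[OF \<mu>(1)]]) (use f in auto)
    then show ?thesis using \<mu>(2) by simp
  qed
  ultimately show "\<exists>W'. openin (weak_topology_on K) W' \<and> W' \<noteq> {} \<and> W' \<subseteq> W \<and> (\<forall>\<mu>\<in>W'. 0 < measure \<mu> (K \<inter> ball x r))"
    by (intro exI[of _ W']) (auto simp: W'_def)
qed

text \<open>
  All atoms can be moved into the dense set of points with \<open>d < q\<close>. Finitely many small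
  balls around them have dimension at most \<open>q\<close> together, and nearby measures still charge these
  balls almost fully.
\<close>
lemma dense_open_almost_full_small_set:
  fixes K :: "'a::euclidean_space set"
  assumes K: "compact K" and q: "0 \<le> q" and c: "c < 1"
    and dense: "\<And>y \<rho>. y \<in> K \<Longrightarrow> \<rho> > 0 \<Longrightarrow> \<exists>x\<in>K \<inter> ball y \<rho>. pointwise_upper_box_dim K x < ereal q"
  shows "holds_on_dense_open (weak_topology_on K)
    (\<lambda>\<mu>. \<exists>E\<in>sets \<mu>. upper_box_dim E \<le> ereal q \<and> c < measure \<mu> E)"
  unfolding holds_on_dense_open_def
proof (intro allI impI, elim conjE)
  fix W assume W: "openin (weak_topology_on K) W" "W \<noteq> {}"
  obtain x0 where x0: "x0 \<in> K" using weak_open_nonempty_carrier[OF W] by auto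
  obtain p \<rho> where p: "finite (set_pmf p)" "set_pmf p \<subseteq> K" "x0 \<in> set_pmf p" "\<rho> > 0"
    and inW: "\<And>k. (\<And>z. z \<in> set_pmf p \<Longrightarrow> finite (set_pmf (k z)) \<and> set_pmf (k z) \<subseteq> K \<inter> ball z \<rho>) \<Longrightarrow>
       pmf_measure_on K (bind_pmf p k) \<in> W"
    using weak_open_contains_spread_pmf[OF K W x0] by blast
  have "\<exists>y r. y \<in> K \<inter> ball z \<rho> \<and> r > 0 \<and> upper_box_dim (K \<inter> ball y r) < ereal q" if "z \<in> set_pmf p" for z
    using dense[of z \<rho>] that p unfolding pointwise_upper_box_dim_less_iff by blast
  then obtain y r where y: "\<And>z. z \<in> set_pmf p \<Longrightarrow> y z \<in> K \<inter> ball z \<rho>"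
    and r: "\<And>z. z \<in> set_pmf p \<Longrightarrow> r z > 0 \<and> upper_box_dim (K \<inter> ball (y z) (r z)) < ereal q" by metis
  define m where "m = bind_pmf p (\<lambda>z. return_pmf (y z))"
  define U where "U = (\<Union>z\<in>set_pmf p. ball (y z) (r z))"
  have set_m: "set_pmf m = y ` set_pmf p" by (auto simp: m_def set_bind_pmf)
  have mK: "set_pmf m \<subseteq> K" using set_m y by auto
  have mW: "pmf_measure_on K m \<in> W" unfolding m_def by (rule inW) (use y in auto)
  obtain f :: "'a \<Rightarrow> real" where f: "continuous_on UNIV f" "\<And>y. 0 \<le> f y" "\<And>y. f y \<le> 1"
    "\<And>x. x \<in> set_pmf m \<Longrightarrow> f x = 1" "\<And>y. y \<notin> U \<Longrightarrow> f y = 0"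
  proof (rule bump_function[of "set_pmf m" U])
    show "closed (set_pmf m)" using p(1) set_m by (auto intro: finite_imp_closed)
    show "set_pmf m \<subseteq> U" using set_m r by (force simp: U_def)
  qed (auto simp: U_def)
  have fK: "continuous_on K f" using f(1) continuous_on_subset by blast
  have "\<bar>measure_pmf.expectation m f - 1\<bar> \<le> 0"
    by (rule expectation_pmf_close) (use p(1) set_m f(4) in auto)
  then have int1: "integral\<^sup>L (pmf_measure_on K m) f = 1" by (simp add: integral_pmf_measure_on[OF mK fK])
  define W' where "W' = W \<inter> {\<mu> \<in> prob_measures_on K. integral\<^sup>L \<mu> f \<in> {c<..}}"
  have "openin (weak_topology_on K) W'"
    unfolding W'_def by (intro openin_Int W openin_weak_topology_basic fK) auto
  moreover have "pmf_measure_on K m \<in> W'"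
    using mW int1 c pmf_measure_on_prob[OF mK] by (simp add: W'_def)
  moreover have "\<exists>E\<in>sets \<mu>. upper_box_dim E \<le> ereal q \<and> c < measure \<mu> E" if "\<mu> \<in> W'" for \<mu>
  proof (intro bexI conjI)
    have \<mu>: "\<mu> \<in> prob_measures_on K" "c < integral\<^sup>L \<mu> f" using that by (auto simp: W'_def)
    show meas: "K \<inter> U \<in> sets \<mu>" by (rule Int_measurable_prob_measures_on[OF \<mu>(1)]) (auto simp: U_def)
    have "integral\<^sup>L \<mu> f \<le> measure \<mu> (K \<inter> U)"
      by (rule integral_le_measure[OF \<mu>(1) fK meas]) (use f in auto)
    then show "c < measure \<mu> (K \<inter> U)" using \<mu>(2) by simp
    have "upper_box_dim (\<Union>z\<in>set_pmf p. K \<inter> ball (y z) (r z)) \<le> ereal q"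
      by (rule upper_box_dim_finite_UN_le[OF p(1) q])
         (use r K in \<open>auto intro: less_imp_le bounded_Int compact_imp_bounded\<close>)
    then show "upper_box_dim (K \<inter> U) \<le> ereal q" by (simp add: U_def)
  qed
  ultimately show "\<exists>W'. openin (weak_topology_on K) W' \<and> W' \<noteq> {} \<and> W' \<subseteq> W \<and>
      (\<forall>\<mu>\<in>W'. \<exists>E\<in>sets \<mu>. upper_box_dim E \<le> ereal q \<and> c < measure \<mu> E)"
    by (intro exI[of _ W']) (auto simp: W'_def)
qed

lemma finite_positive_lower_bound:
  fixes h :: "'i \<Rightarrow> real"
  assumes "finite I" "\<And>i. i \<in> I \<Longrightarrow> 0 < h i"
  shows "\<exists>\<eta>>0. \<forall>i\<in>I. \<eta> \<le> h i"
proof (intro exI conjI ballI)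
  show "0 < Min (insert 1 (h ` I))" using assms by (subst Min_gr_iff) auto
  show "Min (insert 1 (h ` I)) \<le> h i" if "i \<in> I" for i using assms(1) that by (intro Min_le) auto
qed

lemma prob_bind_pmf_le:
  assumes fin: "finite (set_pmf p)" "\<And>z. z \<in> set_pmf p \<Longrightarrow> finite (set_pmf (k z))"
    and le: "\<And>z. z \<in> set_pmf p \<Longrightarrow> measure_pmf.prob (k z) T \<le> c"
  shows "measure_pmf.prob (bind_pmf p k) T \<le> c"
proof -
  have "measure_pmf.prob (bind_pmf p k) T = measure_pmf.expectation (bind_pmf p k) (indicator T)" by simp
  also have "\<dots> = (\<Sum>z\<in>set_pmf p. pmf p z *\<^sub>R measure_pmf.expectation (k z) (indicator T))"
    by (rule pmf_expectation_bind) (use fin in auto)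
  also have "\<dots> \<le> (\<Sum>z\<in>set_pmf p. pmf p z * c)"
    using le by (intro sum_mono) (auto intro!: mult_left_mono)
  also have "\<dots> = c" using fin by (simp add: sum_distrib_right[symmetric] sum_pmf_eq_1)
  finally show ?thesis .
qed

text \<open>
  The reason why typical measures charge no set of small dimension. Atoms in \<open>V\<close> are
  spread over many separated points. If a nearby measure gives \<open>E \<inter> V\<close> mass \<open>e\<close>, then so
  many of these points are close to \<open>E \<inter> V\<close> that \<open>E\<close> has a large covering number at one of the
  finitely many scales involved. Atoms outside the closed set \<open>V\<close> stay away from it and
  do no harm.
\<close>
lemma dense_open_large_sets:
  fixes K V :: "'a::euclidean_space set"
  assumes K: "compact K" and V: "closed V" and t: "0 \<le> t" and e: "e > 0"
    and dim: "\<And>x. x \<in> K \<inter> V \<Longrightarrow> ereal t < pointwise_upper_box_dim K x"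
  shows "holds_on_dense_open (weak_topology_on K)
    (\<lambda>\<mu>. \<forall>E\<in>sets \<mu>. e \<le> measure \<mu> (E \<inter> V) \<longrightarrow>
       (\<exists>r>0. r < e \<and> r powr (- t) \<le> real (covering_number E r)))"
  unfolding holds_on_dense_open_def
proof (intro allI impI, elim conjE)
  fix W assume W: "openin (weak_topology_on K) W" "W \<noteq> {}"
  obtain x0 where x0: "x0 \<in> K" using weak_open_nonempty_carrier[OF W] by auto
  obtain p \<rho> where p: "finite (set_pmf p)" "set_pmf p \<subseteq> K" "x0 \<in> set_pmf p" "\<rho> > 0"
    and inW: "\<And>k. (\<And>z. z \<in> set_pmf p \<Longrightarrow> finite (set_pmf (k z)) \<and> set_pmf (k z) \<subseteq> K \<inter> ball z \<rho>) \<Longrightarrow>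
       pmf_measure_on K (bind_pmf p k) \<in> W"
    using weak_open_contains_spread_pmf[OF K W x0] by blast
  define A where "A = set_pmf p"
  define spread where "spread z r F \<longleftrightarrow> 0 < r \<and> r < e \<and> finite F \<and> F \<subseteq> K \<inter> ball z \<rho> \<and>
      (\<forall>a\<in>F. \<forall>b\<in>F. a \<noteq> b \<longrightarrow> r \<le> dist a b) \<and> 4 / e * (r / 4) powr (- t) \<le> real (card F)" for z r F
  have "\<exists>r F. spread z r F" if z: "z \<in> A \<inter> V" for z
  proof -
    have "ereal t < upper_box_dim (K \<inter> ball z \<rho>)"
    proof (rule less_le_trans)
      show "ereal t < pointwise_upper_box_dim K z" using dim z p(2) by (auto simp: A_def)
      show "pointwise_upper_box_dim K z \<le> upper_box_dim (K \<inter> ball z \<rho>)"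
        unfolding pointwise_upper_box_dim_def using p(4) by (intro INF_lower) simp
    qed
    then obtain r where r: "r > 0" "r < e" "4 / e * (r / 4) powr (- t) \<le> real (covering_number (K \<inter> ball z \<rho>) r)"
      using upper_box_dim_frequent_scale[OF t, of "K \<inter> ball z \<rho>" "4 / e" e] e by auto
    obtain F where "finite F" "F \<subseteq> K \<inter> ball z \<rho>" "\<And>a b. a \<in> F \<Longrightarrow> b \<in> F \<Longrightarrow> a \<noteq> b \<Longrightarrow> r \<le> dist a b"
      "covering_number (K \<inter> ball z \<rho>) r \<le> card F"
      by (rule large_separated_subset[of "K \<inter> ball z \<rho>" r])
         (use r(1) K in \<open>auto intro: bounded_Int compact_imp_bounded\<close>)
    then show ?thesis using r unfolding spread_def by (intro exI[of _ r] exI[of _ F]) auto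
  qed
  then obtain r F where spread: "\<And>z. z \<in> A \<inter> V \<Longrightarrow> spread z (r z) (F z)" by metis
  have r: "\<And>z. z \<in> A \<inter> V \<Longrightarrow> 0 < r z" "\<And>z. z \<in> A \<inter> V \<Longrightarrow> r z < e"
    and F: "\<And>z. z \<in> A \<inter> V \<Longrightarrow> finite (F z)" "\<And>z. z \<in> A \<inter> V \<Longrightarrow> F z \<subseteq> K \<inter> ball z \<rho>"
      "\<And>z a b. z \<in> A \<inter> V \<Longrightarrow> a \<in> F z \<Longrightarrow> b \<in> F z \<Longrightarrow> a \<noteq> b \<Longrightarrow> r z \<le> dist a b"
    and card_F: "\<And>z. z \<in> A \<inter> V \<Longrightarrow> 4 / e * (r z / 4) powr (- t) \<le> real (card (F z))"
    using spread unfolding spread_def by blast+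
  have card_pos: "0 < card (F z)" if z: "z \<in> A \<inter> V" for z
  proof -
    have "0 < 4 / e * (r z / 4) powr (- t)" using r(1)[OF z] e by simp
    then have "0 < real (card (F z))" using card_F[OF z] by linarith
    then show ?thesis by simp
  qed
  define k where "k z = (if z \<in> V then pmf_of_set (F z) else return_pmf z)" for z
  have set_k: "set_pmf (k z) = (if z \<in> V then F z else {z})" if "z \<in> A" for z
    using that card_pos[of z] F(1)[of z] by (auto simp: k_def card_gt_0_iff set_pmf_of_set)
  have fin_k: "finite (set_pmf (k z))" if "z \<in> A" for z using set_k[OF that] F(1)[of z] that by auto
  define m where "m = bind_pmf p k"
  define S where "S = set_pmf m"
  have S_eq: "S = (\<Union>z\<in>A. set_pmf (k z))" by (auto simp: S_def m_def A_def)
  have finS: "finite S" unfolding S_eq using p(1) fin_k by (auto simp: A_def)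
  have kK: "set_pmf (k z) \<subseteq> K \<inter> ball z \<rho>" if "z \<in> A" for z
    using set_k[OF that] F(2)[of z] that p by (auto simp: A_def split: if_splits)
  have SK: "S \<subseteq> K" unfolding S_eq using kK by auto
  have mK: "set_pmf m \<subseteq> K" using SK by (simp add: S_def)
  have mW: "pmf_measure_on K m \<in> W" unfolding m_def by (rule inW) (use fin_k kK in \<open>auto simp: A_def\<close>)
  obtain \<eta>1 where \<eta>1: "\<eta>1 > 0" "\<And>z. z \<in> A \<inter> V \<Longrightarrow> \<eta>1 \<le> r z / 4"
    using finite_positive_lower_bound[of "A \<inter> V" "\<lambda>z. r z / 4"] p(1) r(1) by (auto simp: A_def)
  have "\<exists>\<eta>>0. \<forall>i\<in>S \<times> S - Id. \<eta> \<le> (case i of (a, b) \<Rightarrow> dist a b / 2)"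
    by (rule finite_positive_lower_bound) (use finS in auto)
  then obtain \<eta>2 where "\<eta>2 > 0" and all: "\<forall>i\<in>S \<times> S - Id. \<eta>2 \<le> (case i of (a, b) \<Rightarrow> dist a b / 2)" by blast
  moreover have "\<eta>2 \<le> dist a b / 2" if "a \<in> S" "b \<in> S" "a \<noteq> b" for a b
    using bspec[OF all, of "(a, b)"] that by simp
  ultimately have \<eta>2: "\<eta>2 > 0" "\<And>a b. a \<in> S \<Longrightarrow> b \<in> S \<Longrightarrow> a \<noteq> b \<Longrightarrow> \<eta>2 \<le> dist a b / 2" by auto
  have "\<exists>d>0. ball z d \<inter> V = {}" if "z \<in> A - V" for z
    using V that by (metis Diff_iff disjoint_eq_subset_Compl open_Compl open_contains_ball ComplI)
  then obtain d where d: "\<And>z. z \<in> A - V \<Longrightarrow> 0 < d z" "\<And>z. z \<in> A - V \<Longrightarrow> ball z (d z) \<inter> V = {}" by metis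
  obtain \<eta>3 where \<eta>3: "\<eta>3 > 0" "\<And>z. z \<in> A - V \<Longrightarrow> \<eta>3 \<le> d z"
    using finite_positive_lower_bound[of "A - V" d] p(1) d(1) by (auto simp: A_def)
  \<comment> \<open>Balls of radius \<open>\<eta>\<close> around points of \<open>F z\<close> are small compared with the scale of \<open>z\<close>, those around different points of \<open>S\<close> are disjoint, and those around points of \<open>A\<close> outside \<open>V\<close> miss \<open>V\<close>.\<close>
  define \<eta> where "\<eta> = min \<eta>1 (min \<eta>2 \<eta>3)"
  have \<eta>: "\<eta> > 0" "\<eta> \<le> \<eta>1" "\<eta> \<le> \<eta>2" "\<eta> \<le> \<eta>3" using \<eta>1(1) \<eta>2(1) \<eta>3(1) by (auto simp: \<eta>_def)
  \<comment> \<open>The total loss of mass over all atoms is then at most \<open>e / 4\<close>.\<close>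
  define \<tau> where "\<tau> = e / (4 * (real (card S) + 1))"
  have \<tau>: "\<tau> > 0" "\<tau> * real (card S) \<le> e / 4" using e by (auto simp: \<tau>_def field_simps)
  have "\<exists>f :: 'a \<Rightarrow> real. continuous_on UNIV f \<and> (\<forall>x. 0 \<le> f x \<and> f x \<le> 1) \<and> f a = 1 \<and> (\<forall>x. x \<notin> ball a \<eta> \<longrightarrow> f x = 0)" for a
    using bump_function[of "{a}" "ball a \<eta>"] \<eta>(1) by (metis centre_in_ball closed_singleton empty_subsetI insert_subset open_ball singletonI)
  then obtain f :: "'a \<Rightarrow> 'a \<Rightarrow> real" where f: "\<And>a. continuous_on UNIV (f a)" "\<And>a x. 0 \<le> f a x" "\<And>a x. f a x \<le> 1"
    "\<And>a. f a a = 1" "\<And>a x. x \<notin> ball a \<eta> \<Longrightarrow> f a x = 0" by metis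
  have fK: "continuous_on K (f a)" for a using f(1) continuous_on_subset by blast
  define W' where "W' = W \<inter> {\<mu> \<in> prob_measures_on K. \<forall>a\<in>S. integral\<^sup>L \<mu> (f a) \<in> {pmf m a - \<tau><..}}"
  have "openin (weak_topology_on K) W'"
    unfolding W'_def by (intro openin_Int W openin_weak_topology_finite finS fK) auto
  moreover have "pmf_measure_on K m \<in> W'"
  proof -
    have "pmf m a - \<tau> < integral\<^sup>L (pmf_measure_on K m) (f a)" for a
    proof -
      have "pmf m a = measure_pmf.expectation m (indicator {a})" by (simp add: measure_pmf_single)
      also have "\<dots> \<le> measure_pmf.expectation m (f a)"
        using finS f by (intro integral_mono integrable_measure_pmf_finite) (auto simp: indicator_def S_def)
      finally show ?thesis using \<tau>(1) by (simp add: integral_pmf_measure_on[OF mK fK])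
    qed
    then show ?thesis using mW pmf_measure_on_prob[OF mK] by (simp add: W'_def)
  qed
  moreover have "\<exists>r>0. r < e \<and> r powr (- t) \<le> real (covering_number E r)"
    if \<mu>W: "\<mu> \<in> W'" and E: "E \<in> sets \<mu>" and big: "e \<le> measure \<mu> (E \<inter> V)" for \<mu> E
  proof (rule ccontr)
    assume "\<not> ?thesis"
    then have small: "real (covering_number E s) < s powr (- t)" if "0 < s" "s < e" for s
      using that by (meson not_le)
    have \<mu>: "\<mu> \<in> prob_measures_on K" using \<mu>W by (auto simp: W'_def)
    interpret prob_space \<mu> using prob_measures_onD(1)[OF \<mu>] .
    have EK: "E \<subseteq> K" using sets.sets_into_space[OF E] prob_measures_onD(3)[OF \<mu>] by simp
    have EV: "E \<inter> V \<in> sets \<mu>"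
    proof -
      have "E \<inter> V = E \<inter> (K \<inter> V)" using EK by auto
      then show ?thesis using E Int_measurable_prob_measures_on[OF \<mu>, of V] V by auto
    qed
    define B where "B a = K \<inter> ball a \<eta>" for a
    have B_sets: "B a \<in> sets \<mu>" for a
      unfolding B_def by (rule Int_measurable_prob_measures_on[OF \<mu>]) simp
    have \<mu>B: "pmf m a - \<tau> \<le> measure \<mu> (B a)" if "a \<in> S" for a
    proof -
      have "integral\<^sup>L \<mu> (f a) \<le> measure \<mu> (B a)"
        by (rule integral_le_measure[OF \<mu> fK B_sets]) (use f in \<open>auto simp: B_def\<close>)
      then show ?thesis using \<mu>W that by (auto simp: W'_def)
    qed
    \<comment> \<open>The mass of \<open>E \<inter> V\<close> is bounded through its complement: the balls around atoms outside \<open>T\<close> miss it and carry almost all the mass of those atoms. This needs lower bounds on the mass of balls only, which is what the test functions provide.\<close>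
    define T where "T = {a \<in> S. ball a \<eta> \<inter> (E \<inter> V) \<noteq> {}}"
    have disj: "disjoint_family_on B (S - T)"
      unfolding disjoint_family_on_def
    proof (intro ballI impI)
      fix a b assume ab: "a \<in> S - T" "b \<in> S - T" "a \<noteq> b"
      then have "2 * \<eta> \<le> dist a b" using \<eta>2(2)[of a b] \<eta>(3) by auto
      then have "ball a \<eta> \<inter> ball b \<eta> = {}" by (intro disjoint_ballI) simp
      then show "B a \<inter> B b = {}" by (auto simp: B_def)
    qed
    have "measure \<mu> (E \<inter> V) \<le> measure \<mu> (space \<mu> - (\<Union>a\<in>S - T. B a))"
    proof (rule finite_measure_mono)
      show "E \<inter> V \<subseteq> space \<mu> - (\<Union>a\<in>S - T. B a)"
        using EK prob_measures_onD(3)[OF \<mu>] by (auto simp: B_def T_def)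
      show "space \<mu> - (\<Union>a\<in>S - T. B a) \<in> sets \<mu>" using B_sets finS by (intro sets.compl_sets sets.finite_UN) auto
    qed
    also have "\<dots> = 1 - measure \<mu> (\<Union>a\<in>S - T. B a)"
      using B_sets finS by (intro prob_compl sets.finite_UN) auto
    also have "measure \<mu> (\<Union>a\<in>S - T. B a) = (\<Sum>a\<in>S - T. measure \<mu> (B a))"
      using B_sets finS disj by (intro finite_measure_finite_Union) auto
    also have "1 - \<dots> \<le> 1 - (\<Sum>a\<in>S - T. pmf m a - \<tau>)"
      using \<mu>B by (intro diff_left_mono sum_mono) auto
    also have "\<dots> = 1 - (\<Sum>a\<in>S - T. pmf m a) + \<tau> * real (card (S - T))"
      by (simp add: sum_subtractf)
    also have "(\<Sum>a\<in>S - T. pmf m a) = 1 - (\<Sum>a\<in>T. pmf m a)"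
      using sum.subset_diff[of T S "pmf m"] finS sum_pmf_eq_1[of S m] by (auto simp: S_def T_def)
    also have "(\<Sum>a\<in>T. pmf m a) = measure_pmf.prob m T"
      using finS by (subst measure_measure_pmf_finite) (auto simp: T_def)
    also have "\<dots> \<le> e / 4"
      unfolding m_def
    proof (rule prob_bind_pmf_le[OF p(1)])
      fix z assume "z \<in> set_pmf p"
      then have z: "z \<in> A" by (simp add: A_def)
      show "finite (set_pmf (k z))" using fin_k[OF z] .
      show "measure_pmf.prob (k z) T \<le> e / 4"
      proof (cases "z \<in> V")
        case False
        have "ball z \<eta> \<inter> V = {}"
          using d(2)[of z] \<eta>3(2)[of z] \<eta>(4) z False by (force)
        then have "z \<notin> T" by (auto simp: T_def)
        then show ?thesis using False e by (simp add: k_def)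
      next
        case True
        then have zAV: "z \<in> A \<inter> V" using z by simp
        have "card (F z \<inter> T) \<le> covering_number E (r z / 4)"
        proof (rule card_separated_le_covering_number)
          show "bounded E" using EK K bounded_subset compact_imp_bounded by blast
          fix a assume "a \<in> F z \<inter> T"
          then obtain x where "x \<in> ball a \<eta>" "x \<in> E" by (auto simp: T_def)
          then show "\<exists>x\<in>E. dist a x < r z / 4" using \<eta>1(2)[OF zAV] \<eta>(2) by (intro bexI[of _ x]) auto
        qed (use r(1) F zAV in auto)
        then have "real (card (F z \<inter> T)) \<le> real (covering_number E (r z / 4))" by simp
        also have "\<dots> < (r z / 4) powr (- t)"
          using r(1,2)[OF zAV] by (intro small) auto
        also have "\<dots> \<le> e / 4 * real (card (F z))" using card_F[OF zAV] e by (simp add: field_simps)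
        finally have "real (card (F z \<inter> T)) / real (card (F z)) \<le> e / 4"
          using card_pos[OF zAV] by (simp add: field_simps)
        moreover have "measure_pmf.prob (k z) T = real (card (F z \<inter> T)) / real (card (F z))"
          using True card_pos[OF zAV] F(1)[OF zAV] by (auto simp: k_def measure_pmf_of_set card_gt_0_iff)
        ultimately show ?thesis by simp
      qed
    qed
    also have "\<tau> * real (card (S - T)) \<le> e / 4"
      using \<tau> finS by (intro order_trans[OF mult_left_mono \<tau>(2)]) (auto intro: card_mono)
    finally show False using big e by simp
  qed
  ultimately show "\<exists>W'. openin (weak_topology_on K) W' \<and> W' \<noteq> {} \<and> W' \<subseteq> W \<and>
      (\<forall>\<mu>\<in>W'. \<forall>E\<in>sets \<mu>. e \<le> measure \<mu> (E \<inter> V) \<longrightarrow>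
         (\<exists>r>0. r < e \<and> r powr (- t) \<le> real (covering_number E r)))"
    by (intro exI[of _ W']) (auto simp: W'_def)
qed

section \<open>Typical dimensions\<close>

lemma typical_in_mono:
  assumes "typical_in X P" "\<And>\<mu>. \<mu> \<in> topspace X \<Longrightarrow> P \<mu> \<Longrightarrow> Q \<mu>"
  shows "typical_in X Q"
  using assms gdelta_in_subset unfolding typical_in_def by blast

text \<open>
  Balls centred in \<open>K\<close> are admissible in the infimum by full support, which gives one inequality. For \<open>q\<close>
  below the local dimension, \<open>d \<ge> q\<close> on all of \<open>K\<close>, which gives the other one.
\<close>
lemma small_upper_box_dim_eq_local:
  fixes K :: "'a::euclidean_space set"
  assumes \<mu>: "\<mu> \<in> prob_measures_on K"
    and full: "\<And>x r. x \<in> K \<Longrightarrow> r > 0 \<Longrightarrow> 0 < measure \<mu> (K \<inter> ball x r)"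
    and large: "\<And>(q::rat) t E. 0 \<le> t \<Longrightarrow> t < q \<Longrightarrow> E \<in> sets \<mu> \<Longrightarrow>
      0 < measure \<mu> (E \<inter> {x \<in> K. ereal (of_rat q) \<le> pointwise_upper_box_dim K x}) \<Longrightarrow>
      ereal (of_rat t) \<le> upper_box_dim E"
  shows "small_upper_box_dim \<mu> = local_upper_box_dim K"
proof (rule antisym)
  show "small_upper_box_dim \<mu> \<le> local_upper_box_dim K"
    unfolding local_upper_box_dim_def
  proof (intro INF_greatest)
    fix x and r :: real assume "x \<in> K" "r \<in> {0<..}"
    then show "small_upper_box_dim \<mu> \<le> upper_box_dim (K \<inter> ball x r)"
      unfolding small_upper_box_dim_def
      using full Int_measurable_prob_measures_on[OF \<mu>, of "ball x r"] by (intro INF_lower) auto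
  qed
  show "local_upper_box_dim K \<le> small_upper_box_dim \<mu>"
    unfolding small_upper_box_dim_def
  proof (rule INF_greatest, rule dense_le)
    fix E y assume E: "E \<in> {E \<in> sets \<mu>. measure \<mu> E > 0}" and y: "y < local_upper_box_dim K"
    show "y \<le> upper_box_dim E"
    proof (cases "y < 0")
      case True
      then show ?thesis using upper_box_dim_nonneg[of E] by (meson less_imp_le order_trans)
    next
      case False
      obtain t :: rat where t: "y < ereal (of_rat t)" "ereal (of_rat t) < local_upper_box_dim K"
        using ereal_dense3[OF y] by auto
      obtain q :: rat where q: "ereal (of_rat t) < ereal (of_rat q)" "ereal (of_rat q) < local_upper_box_dim K"
        using ereal_dense3[OF t(2)] by auto
      have "0 < ereal (of_rat t)" by (rule le_less_trans[OF _ t(1)]) (use False in simp)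
      then have t0: "0 \<le> t" by simp
      have "{x \<in> K. ereal (of_rat q) \<le> pointwise_upper_box_dim K x} = K"
      proof -
        have "ereal (of_rat q) \<le> pointwise_upper_box_dim K x" if "x \<in> K" for x
          using less_imp_le[OF q(2)] INF_lower[OF that, of "pointwise_upper_box_dim K"]
          unfolding local_upper_box_dim_eq_INF by (rule order_trans)
        then show ?thesis by auto
      qed
      moreover have "E \<inter> K = E"
        using E sets.sets_into_space[of E \<mu>] prob_measures_onD(3)[OF \<mu>] by auto
      ultimately have "ereal (of_rat t) \<le> upper_box_dim E"
        using large[OF t0, of q E] q(1) E by (simp add: of_rat_less)
      then show ?thesis using t(1) by simp
    qed
  qed
qed

text \<open>
  If \<open>q\<close> is below the maximal local dimension, then \<open>d \<ge> q\<close> on some \<open>K \<inter> ball y \<rho>\<close>. This set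
  has positive measure, so all sets of measure close to 1 meet it in positive measure and
  have dimension at least \<open>t\<close> for any \<open>t < q\<close>. The other inequality comes from the
  almost full sets of small dimension.
\<close>
lemma big_upper_box_dim_eq_max_local:
  fixes K :: "'a::euclidean_space set"
  assumes K: "compact K" and \<mu>: "\<mu> \<in> prob_measures_on K"
    and full: "\<And>x r. x \<in> K \<Longrightarrow> r > 0 \<Longrightarrow> 0 < measure \<mu> (K \<inter> ball x r)"
    and large: "\<And>(q::rat) t E. 0 \<le> t \<Longrightarrow> t < q \<Longrightarrow> E \<in> sets \<mu> \<Longrightarrow>
      0 < measure \<mu> (E \<inter> {x \<in> K. ereal (of_rat q) \<le> pointwise_upper_box_dim K x}) \<Longrightarrow>
      ereal (of_rat t) \<le> upper_box_dim E"
    and small: "\<And>(q::rat) \<epsilon>. 0 \<le> q \<Longrightarrow> max_local_upper_box_dim K < ereal (of_rat q) \<Longrightarrow> \<epsilon> > 0 \<Longrightarrow>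
      \<exists>E\<in>sets \<mu>. upper_box_dim E \<le> ereal (of_rat q) \<and> 1 - \<epsilon> < measure \<mu> E"
  shows "big_upper_box_dim \<mu> = max_local_upper_box_dim K"
proof -
  interpret prob_space \<mu> using prob_measures_onD(1)[OF \<mu>] .
  let ?S = "max_local_upper_box_dim K"
  let ?g = "\<lambda>\<epsilon>. INF E\<in>{E \<in> sets \<mu>. measure \<mu> E > 1 - \<epsilon>}. upper_box_dim E"
  note S_eq = max_local_upper_box_dim_eq[OF compact_imp_bounded[OF K]]
  obtain x0 where x0: "x0 \<in> K" using not_empty prob_measures_onD(3)[OF \<mu>] by auto
  have pw0: "0 \<le> pointwise_upper_box_dim K x" for x
    unfolding pointwise_upper_box_dim_def by (intro INF_greatest upper_box_dim_nonneg)
  have S0: "0 \<le> ?S"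
    unfolding S_eq by (intro SUP_upper2[OF x0] SUP_upper2[of 1] INF_greatest pw0) simp
  have "(?g \<longlongrightarrow> ?S) (at_right 0)"
  proof (rule order_tendstoI)
    fix a assume a: "a < ?S"
    show "\<forall>\<^sub>F \<epsilon> in at_right 0. a < ?g \<epsilon>"
    proof (cases "a < 0")
      case True
      have "0 \<le> ?g \<epsilon>" for \<epsilon> by (intro INF_greatest upper_box_dim_nonneg)
      then have "a < ?g \<epsilon>" for \<epsilon> using True by (rule less_le_trans[rotated])
      then show ?thesis by simp
    next
      case False
      obtain t :: rat where t: "a < ereal (of_rat t)" "ereal (of_rat t) < ?S"
        using ereal_dense3[OF a] by auto
      obtain q :: rat where q: "ereal (of_rat t) < ereal (of_rat q)" "ereal (of_rat q) < ?S"
        using ereal_dense3[OF t(2)] by auto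
      have "0 < ereal (of_rat t)" by (rule le_less_trans[OF _ t(1)]) (use False in simp)
      then have t0: "0 \<le> t" by simp
      have tq: "t < q" using q(1) by (simp add: of_rat_less)
      let ?V = "{x \<in> K. ereal (of_rat q) \<le> pointwise_upper_box_dim K x}"
      obtain y \<rho> where y: "y \<in> K" "\<rho> > 0"
        and yq: "ereal (of_rat q) < (INF x\<in>K \<inter> ball y \<rho>. pointwise_upper_box_dim K x)"
        using q(2) unfolding S_eq less_SUP_iff by auto
      define B where "B = K \<inter> ball y \<rho>"
      have BV: "B \<subseteq> ?V"
      proof
        fix x assume x: "x \<in> B"
        have "(INF x\<in>K \<inter> ball y \<rho>. pointwise_upper_box_dim K x) \<le> pointwise_upper_box_dim K x"
          using x unfolding B_def by (rule INF_lower)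
        then have "ereal (of_rat q) \<le> pointwise_upper_box_dim K x"
          by (rule order_trans[OF less_imp_le[OF yq]])
        then show "x \<in> ?V" using x by (simp add: B_def)
      qed
      have B_sets: "B \<in> sets \<mu>" unfolding B_def by (rule Int_measurable_prob_measures_on[OF \<mu>]) simp
      have V_sets: "?V \<in> sets \<mu>"
        using Int_measurable_prob_measures_on[OF \<mu>, of ?V] closed_pointwise_upper_box_dim_ge[OF K]
        by (simp add: Int_absorb1 Collect_mono_iff subset_iff)
      have "0 < measure \<mu> B" unfolding B_def by (rule full[OF y])
      then have "\<forall>\<^sub>F \<epsilon> in at_right 0. \<epsilon> \<in> {0<..<measure \<mu> B}" by (rule eventually_at_right_real)
      then show ?thesis
      proof eventually_elim
        case (elim \<epsilon>)
        have "ereal (of_rat t) \<le> ?g \<epsilon>"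
        proof (rule INF_greatest)
          fix E assume "E \<in> {E \<in> sets \<mu>. measure \<mu> E > 1 - \<epsilon>}"
          then have E: "E \<in> sets \<mu>" "measure \<mu> E > 1 - \<epsilon>" by auto
          have "measure \<mu> E - measure \<mu> (E \<inter> B) = measure \<mu> (E - B)"
            using finite_measure_Diff'[OF E(1) B_sets] by simp
          also have "\<dots> \<le> measure \<mu> (space \<mu> - B)"
            using E B_sets sets.sets_into_space[OF E(1)] by (intro finite_measure_mono) auto
          also have "\<dots> = 1 - measure \<mu> B" using B_sets by (rule prob_compl)
          finally have "0 < measure \<mu> (E \<inter> B)" using E(2) elim by simp
          also have "\<dots> \<le> measure \<mu> (E \<inter> ?V)"
            using BV E V_sets by (intro finite_measure_mono) auto
          finally show "ereal (of_rat t) \<le> upper_box_dim E" by (rule large[OF t0 tq E(1)])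
        qed
        then show ?case using t(1) by (rule less_le_trans[rotated])
      qed
    qed
  next
    fix a assume "?S < a"
    then obtain q :: rat where q: "?S < ereal (of_rat q)" "ereal (of_rat q) < a"
      using ereal_dense3 by auto
    have "0 < ereal (of_rat q)" using S0 q(1) by (rule le_less_trans)
    then have q0: "0 \<le> q" by simp
    have "\<forall>\<^sub>F \<epsilon> in at_right (0::real). \<epsilon> \<in> {0<..<1}" by (rule eventually_at_right_real) simp
    then show "\<forall>\<^sub>F \<epsilon> in at_right 0. ?g \<epsilon> < a"
    proof eventually_elim
      case (elim \<epsilon>)
      then obtain E where "E \<in> sets \<mu>" "upper_box_dim E \<le> ereal (of_rat q)" "1 - \<epsilon> < measure \<mu> E"
        using small[OF q0 q(1), of \<epsilon>] by auto
      then have "?g \<epsilon> \<le> ereal (of_rat q)" by (intro INF_lower2[of E]) auto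
      then show ?case using q(2) by (rule le_less_trans)
    qed
  qed
  then show ?thesis
    unfolding big_upper_box_dim_def by (intro tendsto_Lim) simp_all
qed

theorem theorem1p1:
  fixes K :: "'a::euclidean_space set"
  assumes "compact K"
  shows "typical_in (weak_topology_on K)
           (\<lambda>\<mu>. small_upper_box_dim \<mu> = local_upper_box_dim K \<and>
                big_upper_box_dim \<mu> = max_local_upper_box_dim K)"
proof -
  let ?d = "pointwise_upper_box_dim K"
  let ?V = "\<lambda>q::rat. {x \<in> K. ereal (of_rat q) \<le> ?d x}"
  obtain D where D: "countable D" "D \<subseteq> K" "K \<subseteq> closure D" using separable .
  define full where "full = (\<lambda>(x, n::nat) (\<mu>::'a measure). 0 < measure \<mu> (K \<inter> ball x (1 / Suc n)))"
  \<comment> \<open>As \<open>n\<close> grows, both the mass threshold and the admissible scales tend to 0, so that a set whose part in \<open>?V q\<close> has positive measure has arbitrarily small good scales.\<close>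
  define large where "large = (\<lambda>(q, t, n::nat) (\<mu>::'a measure). \<forall>E\<in>sets \<mu>. 1 / Suc n \<le> measure \<mu> (E \<inter> ?V q) \<longrightarrow>
    (\<exists>r>0. r < 1 / Suc n \<and> r powr (- of_rat t) \<le> real (covering_number E r)))"
  define small where "small = (\<lambda>(q::rat, n::nat) (\<mu>::'a measure).
    \<exists>E\<in>sets \<mu>. upper_box_dim E \<le> ereal (of_rat q) \<and> 1 - 1 / Suc n < measure \<mu> E)"
  define I where "I = {(q::rat, t::rat, n::nat). 0 \<le> t \<and> t < q}"
  define J where "J = {(q::rat, n::nat). 0 \<le> q \<and> max_local_upper_box_dim K < ereal (of_rat q)}"
  define \<Q> where "\<Q> = full ` (D \<times> UNIV) \<union> large ` I \<union> small ` J"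
  have "countable \<Q>"
    unfolding \<Q>_def using D(1) by (intro countable_Un countable_image countable_SIGMA) (auto intro: countableI_type)
  moreover have "holds_on_dense_open (weak_topology_on K) Q" if Q: "Q \<in> \<Q>" for Q
  proof -
    consider x n where "x \<in> D" "Q = full (x, n)" | q t n where "(q, t, n) \<in> I" "Q = large (q, t, n)"
      | q n where "(q, n) \<in> J" "Q = small (q, n)"
      using Q unfolding \<Q>_def by auto
    then show ?thesis
    proof cases
      case 1
      have "holds_on_dense_open (weak_topology_on K) (\<lambda>\<mu>. 0 < measure \<mu> (K \<inter> ball x (1 / Suc n)))"
        by (rule dense_open_ball_positive[OF assms]) (use 1 D(2) in auto)
      then show ?thesis using 1 by (simp add: full_def)
    next
      case 2
      have "holds_on_dense_open (weak_topology_on K) (\<lambda>\<mu>. \<forall>E\<in>sets \<mu>. 1 / Suc n \<le> measure \<mu> (E \<inter> ?V q) \<longrightarrow>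
        (\<exists>r>0. r < 1 / Suc n \<and> r powr (- of_rat t) \<le> real (covering_number E r)))"
      proof (rule dense_open_large_sets[OF assms closed_pointwise_upper_box_dim_ge[OF assms]])
        show "0 \<le> (of_rat t :: real)" using 2 by (simp add: I_def)
        fix x assume "x \<in> K \<inter> ?V q"
        moreover have "ereal (of_rat t) < ereal (of_rat q)" using 2 by (simp add: I_def of_rat_less)
        ultimately show "ereal (of_rat t) < ?d x" by (blast intro: less_le_trans)
      qed simp
      then show ?thesis using 2 by (simp add: large_def)
    next
      case 3
      have "holds_on_dense_open (weak_topology_on K)
        (\<lambda>\<mu>. \<exists>E\<in>sets \<mu>. upper_box_dim E \<le> ereal (of_rat q) \<and> 1 - 1 / Suc n < measure \<mu> E)"
      proof (rule dense_open_almost_full_small_set[OF assms])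
        show "0 \<le> (of_rat q :: real)" using 3 by (simp add: J_def)
        fix y and \<rho> :: real assume y: "y \<in> K" "\<rho> > 0"
        have "(INF x\<in>K \<inter> ball y \<rho>. ?d x) \<le> max_local_upper_box_dim K"
          unfolding max_local_upper_box_dim_eq[OF compact_imp_bounded[OF assms]]
          using y by (intro SUP_upper2[OF y(1)] SUP_upper2[of \<rho>]) auto
        also have "\<dots> < ereal (of_rat q)" using 3 by (simp add: J_def)
        finally show "\<exists>x\<in>K \<inter> ball y \<rho>. ?d x < ereal (of_rat q)" by (simp add: INF_less_iff)
      qed simp
      then show ?thesis using 3 by (simp add: small_def)
    qed
  qed
  ultimately have "typical_in (weak_topology_on K) (\<lambda>\<mu>. \<forall>Q\<in>\<Q>. Q \<mu>)"
    by (rule typical_in_weak_topology_countable[OF assms])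
  then show ?thesis
  proof (rule typical_in_mono)
    fix \<mu> assume "\<mu> \<in> topspace (weak_topology_on K)" and Q: "\<forall>Q\<in>\<Q>. Q \<mu>"
    then have \<mu>: "\<mu> \<in> prob_measures_on K" by (simp add: topspace_weak_topology_on)
    interpret prob_space \<mu> using prob_measures_onD(1)[OF \<mu>] .
    have small_scale: "\<exists>n. 1 / real (Suc n) < \<delta>" if "\<delta> > 0" for \<delta>
      using reals_Archimedean[OF that] by (simp add: inverse_eq_divide)
    have full': "0 < measure \<mu> (K \<inter> ball x r)" if x: "x \<in> K" "r > 0" for x r
    proof -
      obtain n where n: "1 / real (Suc n) < r / 2" using small_scale[of "r / 2"] x(2) by auto
      obtain z where z: "z \<in> D" "dist z x < 1 / Suc n"
        using D(3) x(1) closure_approachable[of x D] by (metis of_nat_0_less_iff subsetD zero_less_Suc zero_less_divide_1_iff)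
      have "full (z, n) \<mu>" using Q z(1) unfolding \<Q>_def by blast
      then have "0 < measure \<mu> (K \<inter> ball z (1 / Suc n))" by (simp add: full_def)
      also have "\<dots> \<le> measure \<mu> (K \<inter> ball x r)"
      proof (rule finite_measure_mono)
        have "ball z (1 / Suc n) \<subseteq> ball x r"
        proof
          fix w assume "w \<in> ball z (1 / Suc n)"
          then show "w \<in> ball x r" using dist_triangle[of x w z] n z(2) by (simp add: dist_commute)
        qed
        then show "K \<inter> ball z (1 / Suc n) \<subseteq> K \<inter> ball x r" by auto
      qed (rule Int_measurable_prob_measures_on[OF \<mu>], simp)
      finally show ?thesis .
    qed
    have large': "ereal (of_rat t) \<le> upper_box_dim E"
      if h: "0 \<le> t" "t < q" "E \<in> sets \<mu>" "0 < measure \<mu> (E \<inter> ?V q)" for q t :: rat and E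
    proof (rule upper_box_dim_geI)
      fix \<delta> :: real assume "\<delta> > 0"
      then obtain n where n: "1 / real (Suc n) < min \<delta> (measure \<mu> (E \<inter> ?V q))"
        using small_scale[of "min \<delta> (measure \<mu> (E \<inter> ?V q))"] h(4) by auto
      have "(q, t, n) \<in> I" using h by (simp add: I_def)
      then have "large (q, t, n) \<mu>" using Q unfolding \<Q>_def by blast
      moreover have "1 / real (Suc n) \<le> measure \<mu> (E \<inter> ?V q)" using n by linarith
      ultimately obtain r where "r > 0" "r < 1 / Suc n" "r powr (- of_rat t) \<le> real (covering_number E r)"
        using h(3) unfolding large_def prod.case by blast
      then show "\<exists>r>0. r < \<delta> \<and> r powr (- of_rat t) \<le> real (covering_number E r)"
        using n by (intro exI[of _ r]) auto
    qed
    have small': "\<exists>E\<in>sets \<mu>. upper_box_dim E \<le> ereal (of_rat q) \<and> 1 - \<epsilon> < measure \<mu> E"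
      if h: "0 \<le> q" "max_local_upper_box_dim K < ereal (of_rat q)" "\<epsilon> > 0" for q :: rat and \<epsilon>
    proof -
      obtain n where n: "1 / real (Suc n) < \<epsilon>" using small_scale[OF h(3)] by auto
      have "(q, n) \<in> J" using h by (simp add: J_def)
      then have "small (q, n) \<mu>" using Q unfolding \<Q>_def by blast
      then obtain E where "E \<in> sets \<mu>" "upper_box_dim E \<le> ereal (of_rat q)" "1 - 1 / Suc n < measure \<mu> E"
        unfolding small_def prod.case by blast
      then show ?thesis using n by (intro bexI[of _ E]) auto
    qed
    have "small_upper_box_dim \<mu> = local_upper_box_dim K"
      by (rule small_upper_box_dim_eq_local[OF \<mu>]) (rule full' large', assumption+)+
    moreover have "big_upper_box_dim \<mu> = max_local_upper_box_dim K"
      by (rule big_upper_box_dim_eq_max_local[OF assms \<mu>]) (rule full' large' small', assumption+)+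
    ultimately show "small_upper_box_dim \<mu> = local_upper_box_dim K \<and> big_upper_box_dim \<mu> = max_local_upper_box_dim K" ..
  qed
qed

end
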